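(* Let the cone $\mathcal{C}$ be given by $\ell_*\in\mathbb{N}$ and functions $\hat\omega,\mathring\omega$ as in the context, fix $r\in\mathbb{N}$ with $\hat\omega(r)\mathring\omega(r)<1$, and let $$\mathfrak{C}(m):=\frac{\hat\omega(m)\,\mathring\omega(r)}{1-\hat\omega(r)\,\mathring\omega(r)}.$$ Let $\varepsilon>0$ be a tolerance and let $f\in\mathcal{C}$. Define $$m=\min\{m'\ge \ell_*+r:\ \mathfrak{C}(m')\,\widetilde S_{m'-r,m'}(f)\le\varepsilon\}.$$ Then the adaptive algorithm described in the context is successful, that is, it returns $\hat I_m(f)$ and $$\left|\int_{[0,1)^d}f(\boldsymbol x)\,d\boldsymbol x-\hat I_m(f)\right|\le\varepsilon .$$ Thus the number of function data needed is $b^m$. Moreover, defining $$m^*=\min\{m'\ge\ell_*+r:\ \mathfrak{C}(m')\,[1+\hat\omega(r)\mathring\omega(r)]\,S_{m'-r}(f)\le\varepsilon\},$$ one has $b^m\le b^{m^*}$, and the computational cost of the algorithm is bounded by $$\mathrm{cost}(\hat I_m,f,\varepsilon)\le \$(f)\,b^{m^*}+c\,m^*\,b^{m^*},$$ where $\$(f)$ is the cost of evaluating $f$ at one data point and $c$ is a constant independent of $f$ and $\varepsilon$.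
   Context: Let $d\in\mathbb{N}$, let $b$ be a prime number, $\mathbb{N}_0=\{0,1,2,\dots\}$, $\mathbb{N}=\{1,2,\dots\}$, and $\mathbb{F}_n:=\{0,\dots,n-1\}$ (a set of integers). "mod 1" is componentwise; $\boldsymbol x\oplus\boldsymbol y:=(\boldsymbol x+\boldsymbol y)\bmod 1$ on $[0,1)^d$; $\mathrm{i}=\sqrt{-1}$. Embedded rank-1 lattices. Given $\boldsymbol a_0\in\{1,\dots,b-1\}^d$ and $\boldsymbol a_m\in\mathbb{F}_b^d$ for $m\in\mathbb{N}$, set $\boldsymbol z_1=b^{-1}\boldsymbol a_0$ and $\boldsymbol z_{b^m}=b^{-1}(\boldsymbol z_{b^{m-1}}+\boldsymbol a_m)$ for $m\in\mathbb{N}$. Set $\boldsymbol z_0=\boldsymbol 0$ and, for $i\in\mathbb{N}$ with $b$-ary expansion $i=i_0+i_1b+i_2b^2+\cdots$, $\boldsymbol z_i=\sum_{\ell\ge 0}i_\ell\boldsymbol z_{b^\ell}\bmod 1$. For $\boldsymbol k\in\mathbb{Z}^d$, $\boldsymbol x\in[0,1)^d$ let $\langle\boldsymbol k,\boldsymbol x\rangle:=\boldsymbol k^T\boldsymbol x\bmod 1\in[0,1)$. It is assumed throughout that if $\langle\boldsymbol k,\boldsymbol z_{b^m}\rangle=0$ for all $m\in\mathbb{N}_0$ then $\boldsymbol k=\boldsymbol 0$. Cubature rule. Fix a shift $\boldsymbol\Delta\in[0,1)^d$ and set $\hat I_m(f):=b^{-m}\sum_{i=0}^{b^m-1}f(\boldsymbol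 z_i\oplus\boldsymbol\Delta)$ for $m\in\mathbb{N}_0$. Wavenumber map. Define $\tilde\nu_m:\mathbb{Z}^d\to\mathbb{F}_{b^m}$ by $\tilde\nu_0(\boldsymbol k):=0$ and $\tilde\nu_m(\boldsymbol k):=b^m\langle\boldsymbol k,\boldsymbol z_{b^{m-1}}\rangle$ for $m\in\mathbb{N}$; for each $\boldsymbol k,m$ one has $\tilde\nu_{m+1}(\boldsymbol k)=\tilde\nu_m(\boldsymbol k)+ab^m$ for a unique $a\in\mathbb{F}_b$. Fix a one-to-one and onto map $\tilde{\boldsymbol k}:\mathbb{N}_0\to\mathbb{Z}^d$ chosen recursively as follows: $\tilde{\boldsymbol k}(0)=\boldsymbol 0$; for each $m\in\mathbb{N}_0$ and $\kappa\in\mathbb{F}_{b^m}$, let $a\in\mathbb{F}_b$ be such that $\tilde\nu_{m+1}(\tilde{\boldsymbol k}(\kappa))=\tilde\nu_m(\tilde{\boldsymbol k}(\kappa))+ab^m$; (i) if $a\ne0$, $\tilde{\boldsymbol k}(\kappa+ab^m)$ is some element of $\{\boldsymbol k:\tilde\nu_{m+1}(\boldsymbol k)=\tilde\nu_m(\tilde{\boldsymbol k}(\kappa))\}$; (ii) for each $a'\in\{1,\dots,b-1\}\setminus\{a\}$, $\tilde{\boldsymbol k}(\kappa+a'b^m)$ is some element of $\{\boldsymbol k:\tilde\nu_{m+1}(\boldsymbol k)=\tilde\nu_m(\tilde{\boldsymbol k}(\kappa))+a'b^m\}$. Fourier coefficients. For $f$ on $[0,1)^d$ put $\hat f(\boldsymbol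 k)=\int_{[0,1)^d}f(\boldsymbol x)e^{-2\pi\mathrm{i}\langle\boldsymbol k,\boldsymbol x\rangle}\,d\boldsymbol x$ and $\tilde f_m(\boldsymbol k):=b^{-m}\sum_{i=0}^{b^m-1}e^{-2\pi\mathrm{i}\langle\boldsymbol k,\boldsymbol z_i\oplus\boldsymbol\Delta\rangle}f(\boldsymbol z_i\oplus\boldsymbol\Delta)$; write $\hat f_\kappa:=\hat f(\tilde{\boldsymbol k}(\kappa))$ and $\tilde f_{m,\kappa}:=\tilde f_m(\tilde{\boldsymbol k}(\kappa))$. For $\ell,m\in\mathbb{N}_0$, $\ell\le m$, define $$S_m(f)=\sum_{\kappa=\lfloor b^{m-1}\rfloor}^{b^m-1}|\hat f_\kappa|,\qquad \widehat S_{\ell,m}(f)=\sum_{\kappa=\lfloor b^{\ell-1}\rfloor}^{b^\ell-1}\sum_{\lambda=1}^\infty|\hat f_{\kappa+\lambda b^m}|,$$ $$\check S_m(f)=\sum_{\kappa=b^m}^\infty|\hat f_\kappa|,\qquad \widetilde S_{\ell,m}(f)=\sum_{\kappa=\lfloor b^{\ell-1}\rfloor}^{b^\ell-1}|\tilde f_{m,\kappa}|.$$ Cone. Let $\ell_*\in\mathbb{N}$ and let $\hat\omega,\mathring\omega:\mathbb{N}_0\to[0,\infty)$ be bounded functions such that some $r$ satisfies $\hat\omega(r)\mathring\omega(r)<1$ and $\lim_{m\to\infty}\mathring\omega(m)=0$. Define $$\mathcal{C}:=\{f\in AC([0,1)^d):\ \widehat S_{\ell,m}(f)\le\hat\omega(m-\ell)\check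 S_m(f)\ \text{for all }\ell\le m;\ \ \check S_m(f)\le\mathring\omega(m-\ell)S_\ell(f)\ \text{for all }\ell_*\le\ell\le m\}.$$ Here $AC([0,1)^d)$ denotes absolutely continuous functions; throughout, integrands are absolutely continuous (in particular continuous) and periodic with period 1 in each variable, with absolutely summable Fourier coefficients, so that $f(\boldsymbol x)=\sum_{\boldsymbol k\in\mathbb{Z}^d}\hat f(\boldsymbol k)e^{2\pi\mathrm{i}\langle\boldsymbol k,\boldsymbol x\rangle}$ for all $\boldsymbol x$. Algorithm. Given $r,\ell_*,\hat\omega,\mathring\omega$ and a tolerance $\varepsilon$, initialize $m=\ell_*+r$. Step 1: compute $\widetilde S_{m-r,m}(f)$ from the values $f(\boldsymbol z_i\oplus\boldsymbol\Delta)$, $i\in\mathbb{F}_{b^m}$ (values from earlier iterations are reused). Step 2: if $\mathfrak{C}(m)\widetilde S_{m-r,m}(f)\le\varepsilon$, return $\hat I_m(f)$; otherwise increase $m$ by one and go to Step 1. Cost model. The cost is the cost of all function evaluations ($\$(f)$ each) plus the number of arithmetic operations performed on the function data. The discrete coefficients are computed by a fast Fourier transform: $|\tilde f_{m,\kappa}|=|Y_m(\tilde\nu_m(\tilde{\boldsymbol k}(\kappa)))|$, where for $\nu\in\mathbb{F}_{b^m}$, with $\bar\nu_\ell:=\nu\bmod b^\ell$, $Y_m(\nu)=b^{-m}\sum_{i_{m-1}=0}^{b-1}\cdots\sum_{i_0=0}^{b-1}f(\boldsymbol z_{i_0+\cdots+i_{m-1}b^{m-1}}\oplus\boldsymbol\Delta)\exp(-2\pi\mathrm{i}\sum_{\ell=0}^{m-1}i_\ell\bar\nu_{\ell+1}b^{-\ell-1})$,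 evaluated for all $\nu$ by summing successively over $i_0,i_1,\dots,i_{m-1}$. The integers $\tilde\nu_m(\tilde{\boldsymbol k}(\kappa))$ and the complex exponentials are regarded as available. *)

theory Defs
  imports "HOL-Analysis.Analysis"
begin

text \<open>The dimension \<open>d\<close> is \<open>CARD('d)\<close>.\<close>

definition unit_cube :: "(real^'d) set" where
  "unit_cube = {x. \<forall>j. 0 \<le> x $ j \<and> x $ j < 1}"

definition frac_vec :: "real^'d \<Rightarrow> real^'d" where
  "frac_vec x = (\<chi> j. frac (x $ j))"

definition oplus :: "real^'d \<Rightarrow> real^'d \<Rightarrow> real^'d" (infixl "\<oplus>" 65) where
  "x \<oplus> y = frac_vec (x + y)"

text \<open>\<open>z_pow b a m\<close> is the node \<open>z\<close> with index \<open>b ^ m\<close>.\<close>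

primrec z_pow :: "nat \<Rightarrow> (nat \<Rightarrow> nat^'d) \<Rightarrow> nat \<Rightarrow> real^'d" where
  "z_pow b a 0 = (\<chi> j. real (a 0 $ j) / real b)"
| "z_pow b a (Suc m) = (\<chi> j. (z_pow b a m $ j + real (a (Suc m) $ j)) / real b)"

text \<open>The \<open>b\<close>-ary digits of \<open>i\<close> beyond position \<open>i\<close> vanish, so the sum over
  \<open>l \<le> i\<close> is the sum over all digits.\<close>

definition z_node :: "nat \<Rightarrow> (nat \<Rightarrow> nat^'d) \<Rightarrow> nat \<Rightarrow> real^'d" where
  "z_node b a i = frac_vec (\<Sum>l\<le>i. real (i div b ^ l mod b) *\<^sub>R z_pow b a l)"

definition lpair :: "int^'d \<Rightarrow> real^'d \<Rightarrow> real" where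
  "lpair k x = frac (\<Sum>j\<in>UNIV. real_of_int (k $ j) * x $ j)"

definition lattice_digits :: "nat \<Rightarrow> (nat \<Rightarrow> nat^'d) \<Rightarrow> bool" where
  "lattice_digits b a \<longleftrightarrow>
     (\<forall>j. a 0 $ j \<in> {1..b - 1}) \<and>
     (\<forall>m\<ge>1. \<forall>j. a m $ j \<in> {0..<b}) \<and>
     (\<forall>k. (\<forall>m. lpair k (z_pow b a m) = 0) \<longrightarrow> k = 0)"

definition cubature :: "nat \<Rightarrow> (nat \<Rightarrow> nat^'d) \<Rightarrow> real^'d \<Rightarrow> nat \<Rightarrow> (real^'d \<Rightarrow> complex) \<Rightarrow> complex" where
  "cubature b a \<Delta> m f = (\<Sum>i<b ^ m. f (z_node b a i \<oplus> \<Delta>)) / of_nat (b ^ m)"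

text \<open>The real number under the floor is already an integer, see \<open>wavenum_Suc_real\<close> below.\<close>

definition wavenum :: "nat \<Rightarrow> (nat \<Rightarrow> nat^'d) \<Rightarrow> nat \<Rightarrow> int^'d \<Rightarrow> nat" where
  "wavenum b a m k =
     (case m of 0 \<Rightarrow> 0 | Suc n \<Rightarrow> nat \<lfloor>real (b ^ m) * lpair k (z_pow b a n)\<rfloor>)"

lemma z_pow_scaled_int:
  assumes "b > 0"
  shows "real (b ^ Suc m) * z_pow b a m $ j \<in> \<int>"
proof (induction m)
  case 0
  have "real (b ^ Suc 0) * z_pow b a 0 $ j = real (a 0 $ j)"
    using assms by simp
  then show ?case by (simp only: Ints_of_nat)
next
  case (Suc m)
  have "real (b ^ Suc (Suc m)) * z_pow b a (Suc m) $ j =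
        real (b ^ Suc m) * (z_pow b a m $ j + real (a (Suc m) $ j))"
    using assms by simp
  also have "\<dots> = real (b ^ Suc m) * z_pow b a m $ j + real (b ^ Suc m * a (Suc m) $ j)"
    by (simp only: distrib_left of_nat_mult)
  also have "\<dots> \<in> \<int>"
    by (rule Ints_add[OF Suc.IH Ints_of_nat])
  finally show ?case .
qed

lemma wavenum_Suc_real:
  assumes "b > 0"
  shows "real (wavenum b a (Suc m) k) = real (b ^ Suc m) * lpair k (z_pow b a m)"
proof -
  define B where "B = b ^ Suc m"
  define s where "s = (\<Sum>j\<in>UNIV. real_of_int (k $ j) * z_pow b a m $ j)"
  define t where "t = real B * lpair k (z_pow b a m)"
  have "real B * s = (\<Sum>j\<in>UNIV. real_of_int (k $ j) * (real B * z_pow b a m $ j))"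
    unfolding s_def sum_distrib_left by (rule sum.cong) (auto simp only: mult.left_commute)
  also have "\<dots> \<in> \<int>"
    unfolding B_def by (intro Ints_sum Ints_mult Ints_of_int z_pow_scaled_int assms)
  finally have s: "real B * s \<in> \<int>" .
  have "t = real B * s - real B * of_int \<lfloor>s\<rfloor>"
    unfolding t_def lpair_def s_def[symmetric] frac_def by (rule right_diff_distrib)
  then have "t \<in> \<int>"
    using Ints_diff[OF s Ints_mult[OF Ints_of_nat Ints_of_int]] by simp
  then obtain n where n: "t = of_int n" by (rule Ints_cases)
  have "t \<ge> 0"
    unfolding t_def lpair_def by (intro mult_nonneg_nonneg frac_ge_0 of_nat_0_le_iff)
  then have "n \<ge> 0" using n by simp
  have "wavenum b a (Suc m) k = nat \<lfloor>t\<rfloor>"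
    unfolding wavenum_def t_def B_def by (simp only: nat.case)
  then show ?thesis
    using n \<open>n \<ge> 0\<close> unfolding t_def B_def by simp
qed

definition wavenumber_map :: "nat \<Rightarrow> (nat \<Rightarrow> nat^'d) \<Rightarrow> (nat \<Rightarrow> int^'d) \<Rightarrow> bool" where
  "wavenumber_map b a kt \<longleftrightarrow> bij kt \<and> kt 0 = 0 \<and>
     (\<forall>m. \<forall>\<kappa><b ^ m. \<forall>\<alpha><b.
        wavenum b a (Suc m) (kt \<kappa>) = wavenum b a m (kt \<kappa>) + \<alpha> * b ^ m \<longrightarrow>
          (\<alpha> \<noteq> 0 \<longrightarrow>
             wavenum b a (Suc m) (kt (\<kappa> + \<alpha> * b ^ m)) = wavenum b a m (kt \<kappa>)) \<and>
          (\<forall>\<beta>\<in>{1..b - 1} - {\<alpha>}.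
             wavenum b a (Suc m) (kt (\<kappa> + \<beta> * b ^ m)) = wavenum b a m (kt \<kappa>) + \<beta> * b ^ m))"

definition cube_integral :: "(real^'d \<Rightarrow> complex) \<Rightarrow> complex" where
  "cube_integral f = (LINT x:unit_cube|lborel. f x)"

definition fourier_coeff :: "(real^'d \<Rightarrow> complex) \<Rightarrow> int^'d \<Rightarrow> complex" where
  "fourier_coeff f k =
     cube_integral (\<lambda>x. f x * exp (- 2 * of_real pi * \<i> * of_real (lpair k x)))"

definition disc_coeff ::
  "nat \<Rightarrow> (nat \<Rightarrow> nat^'d) \<Rightarrow> real^'d \<Rightarrow> nat \<Rightarrow> (real^'d \<Rightarrow> complex) \<Rightarrow> int^'d \<Rightarrow> complex" where
  "disc_coeff b a \<Delta> m f k =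
     (\<Sum>i<b ^ m. exp (- 2 * of_real pi * \<i> * of_real (lpair k (z_node b a i \<oplus> \<Delta>)))
                 * f (z_node b a i \<oplus> \<Delta>)) / of_nat (b ^ m)"

text \<open>With the truncating division on \<open>nat\<close>, \<open>b ^ m div b\<close> is the floor of \<open>b\<close> to the power
  \<open>m - 1\<close>, which is \<open>0\<close> for \<open>m = 0\<close>.\<close>

definition S_sum :: "nat \<Rightarrow> (nat \<Rightarrow> int^'d) \<Rightarrow> nat \<Rightarrow> (real^'d \<Rightarrow> complex) \<Rightarrow> real" where
  "S_sum b kt m f = (\<Sum>\<kappa>\<in>{b ^ m div b..<b ^ m}. norm (fourier_coeff f (kt \<kappa>)))"

definition S_hat :: "nat \<Rightarrow> (nat \<Rightarrow> int^'d) \<Rightarrow> nat \<Rightarrow> nat \<Rightarrow> (real^'d \<Rightarrow> complex) \<Rightarrow> real" where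
  "S_hat b kt l m f =
     (\<Sum>\<kappa>\<in>{b ^ l div b..<b ^ l}. \<Sum>\<^sub>\<infinity>\<mu>\<in>{1..}. norm (fourier_coeff f (kt (\<kappa> + \<mu> * b ^ m))))"

definition S_check :: "nat \<Rightarrow> (nat \<Rightarrow> int^'d) \<Rightarrow> nat \<Rightarrow> (real^'d \<Rightarrow> complex) \<Rightarrow> real" where
  "S_check b kt m f = (\<Sum>\<^sub>\<infinity>\<kappa>\<in>{b ^ m..}. norm (fourier_coeff f (kt \<kappa>)))"

definition S_tilde ::
  "nat \<Rightarrow> (nat \<Rightarrow> nat^'d) \<Rightarrow> real^'d \<Rightarrow> (nat \<Rightarrow> int^'d) \<Rightarrow> nat \<Rightarrow> nat \<Rightarrow>
   (real^'d \<Rightarrow> complex) \<Rightarrow> real" where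
  "S_tilde b a \<Delta> kt l m f =
     (\<Sum>\<kappa>\<in>{b ^ l div b..<b ^ l}. norm (disc_coeff b a \<Delta> m f (kt \<kappa>)))"

definition abs_continuous_on_Icc :: "real \<Rightarrow> real \<Rightarrow> (real \<Rightarrow> complex) \<Rightarrow> bool" where
  "abs_continuous_on_Icc A B g \<longleftrightarrow>
     (\<forall>e>0. \<exists>\<delta>>0. \<forall>n (u :: nat \<Rightarrow> real) v.
        (\<forall>i<n. A \<le> u i \<and> u i \<le> v i \<and> v i \<le> B) \<and>
        (\<forall>i<n. \<forall>j<n. i \<noteq> j \<longrightarrow> {u i<..<v i} \<inter> {u j<..<v j} = {}) \<and>
        (\<Sum>i<n. v i - u i) < \<delta>
        \<longrightarrow> (\<Sum>i<n. norm (g (v i) - g (u i))) < e)"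

text \<open>Absolute continuity in several variables has inequivalent definitions.  The one used here is
  continuity together with absolute continuity on almost every line parallel to a coordinate
  axis.  For \<open>d = 1\<close> this is the classical notion, and for \<open>d > 1\<close> it is implied by absolute
  continuity in the sense of Hardy and Krause, by absolute continuity
  in each variable separately (for continuous functions), and by that in the sense of Tonelli.\<close>

definition abs_continuous_cube :: "(real^'d \<Rightarrow> complex) \<Rightarrow> bool" where
  "abs_continuous_cube f \<longleftrightarrow> continuous_on UNIV f \<and>
     (\<forall>i. AE x in lborel. abs_continuous_on_Icc 0 1 (\<lambda>t. f (\<chi> j. if j = i then t else x $ j)))"

text \<open>Functions on the half-open unit cube are represented by their periodic extensions.\<close>

definition AC_integrands :: "(real^'d \<Rightarrow> complex) set" where
  "AC_integrands = {f.
     (\<forall>x k. f (x + (\<chi> j. real_of_int (k $ j))) = f x) \<and>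
     abs_continuous_cube f \<and>
     (\<lambda>k. norm (fourier_coeff f k)) summable_on UNIV}"

definition integrand_cone ::
  "nat \<Rightarrow> (nat \<Rightarrow> int^'d) \<Rightarrow> nat \<Rightarrow> (nat \<Rightarrow> real) \<Rightarrow> (nat \<Rightarrow> real) \<Rightarrow> (real^'d \<Rightarrow> complex) set" where
  "integrand_cone b kt ls \<omega>h \<omega>r = {f \<in> AC_integrands.
     (\<forall>l m. l \<le> m \<longrightarrow> S_hat b kt l m f \<le> \<omega>h (m - l) * S_check b kt m f) \<and>
     (\<forall>l m. ls \<le> l \<and> l \<le> m \<longrightarrow> S_check b kt m f \<le> \<omega>r (m - l) * S_sum b kt l f)}"

definition err_const :: "(nat \<Rightarrow> real) \<Rightarrow> (nat \<Rightarrow> real) \<Rightarrow> nat \<Rightarrow> nat \<Rightarrow> real" where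
  "err_const \<omega>h \<omega>r r m = \<omega>h m * \<omega>r r / (1 - \<omega>h r * \<omega>r r)"

text \<open>A computation carries its result, the number of function evaluations and the number of
  arithmetic operations on function data.  Only the five primitives \<open>feval\<close> to \<open>leqC\<close> incur a
  cost; each counts as one.\<close>

datatype 'a run = Run (result: 'a) (evals: nat) (ops: nat)

definition ret :: "'a \<Rightarrow> 'a run" where
  "ret x = Run x 0 0"

definition bindC :: "'a run \<Rightarrow> ('a \<Rightarrow> 'b run) \<Rightarrow> 'b run" (infixl "\<triangleright>" 54) where
  "p \<triangleright> q = (let p' = q (result p) in Run (result p') (evals p + evals p') (ops p + ops p'))"

definition feval :: "('a \<Rightarrow> 'b) \<Rightarrow> 'a \<Rightarrow> 'b run" where
  "feval f x = Run (f x) 1 0"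

definition addC :: "'a::plus \<Rightarrow> 'a \<Rightarrow> 'a run" where
  "addC x y = Run (x + y) 0 1"

definition mulC :: "'a::times \<Rightarrow> 'a \<Rightarrow> 'a run" where
  "mulC x y = Run (x * y) 0 1"

definition absC :: "complex \<Rightarrow> real run" where
  "absC x = Run (norm x) 0 1"

definition leqC :: "real \<Rightarrow> real \<Rightarrow> bool run" where
  "leqC x y = Run (x \<le> y) 0 1"

primrec mapC :: "('a \<Rightarrow> 'b run) \<Rightarrow> 'a list \<Rightarrow> 'b list run" where
  "mapC g [] = ret []"
| "mapC g (x # xs) = g x \<triangleright> (\<lambda>y. mapC g xs \<triangleright> (\<lambda>ys. ret (y # ys)))"

primrec sumC :: "'a::monoid_add list \<Rightarrow> 'a run" where
  "sumC [] = ret 0"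
| "sumC (x # xs) = sumC xs \<triangleright> (\<lambda>s. addC x s)"

text \<open>Stage \<open>n\<close> of the fast Fourier transform performs the summation over the digit \<open>i\<^sub>n\<close>.
  Before it, position \<open>\<nu> + i\<^sub>n * b ^ n + i\<^bsub>n+1\<^esub> * b ^ (n + 1) + \<dots>\<close> of the array, with
  \<open>\<nu> < b ^ n\<close>, holds the inner sum over \<open>i\<^sub>0, \<dots>, i\<^bsub>n-1\<^esub>\<close> belonging to the residue \<open>\<nu>\<close> and to the
  digits \<open>i\<^sub>n, i\<^bsub>n+1\<^esub>, \<dots>\<close>.  The exponentials and all indices are available without cost.\<close>

definition fft_entry :: "nat \<Rightarrow> nat \<Rightarrow> complex list \<Rightarrow> nat \<Rightarrow> complex run" where
  "fft_entry b n ys p =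
     (let \<nu> = p mod b ^ Suc n; hi = p div b ^ Suc n in
        mapC (\<lambda>i. mulC (exp (- 2 * of_real pi * \<i> * of_nat i * of_nat \<nu> / of_nat (b ^ Suc n)))
                       (ys ! (\<nu> mod b ^ n + i * b ^ n + hi * b ^ Suc n))) [0..<b]
        \<triangleright> sumC)"

definition fft_stage :: "nat \<Rightarrow> nat \<Rightarrow> complex list \<Rightarrow> complex list run" where
  "fft_stage b n ys = mapC (fft_entry b n ys) [0..<length ys]"

primrec fft_stages :: "nat \<Rightarrow> nat \<Rightarrow> complex list \<Rightarrow> complex list run" where
  "fft_stages b 0 ys = ret ys"
| "fft_stages b (Suc n) ys = fft_stages b n ys \<triangleright> fft_stage b n"

definition fft :: "nat \<Rightarrow> nat \<Rightarrow> complex list \<Rightarrow> complex list run" where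
  "fft b m ys = fft_stages b m ys \<triangleright> mapC (mulC (1 / of_nat (b ^ m)))"

definition comp_S_tilde ::
  "nat \<Rightarrow> (nat \<Rightarrow> nat^'d) \<Rightarrow> (nat \<Rightarrow> int^'d) \<Rightarrow> nat \<Rightarrow> nat \<Rightarrow> complex list \<Rightarrow> real run" where
  "comp_S_tilde b a kt l m ys =
     fft b m ys \<triangleright>
     (\<lambda>Y. mapC (\<lambda>\<kappa>. absC (Y ! wavenum b a m (kt \<kappa>))) [b ^ l div b..<b ^ l]) \<triangleright>
     sumC"

definition comp_cubature :: "nat \<Rightarrow> nat \<Rightarrow> complex list \<Rightarrow> complex run" where
  "comp_cubature b m ys = sumC ys \<triangleright> mulC (1 / of_nat (b ^ m))"

definition sample ::
  "nat \<Rightarrow> (nat \<Rightarrow> nat^'d) \<Rightarrow> real^'d \<Rightarrow> (real^'d \<Rightarrow> complex) \<Rightarrow> nat \<Rightarrow> nat \<Rightarrow> complex list run" where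
  "sample b a \<Delta> f i i' = mapC (\<lambda>i. feval f (z_node b a i \<oplus> \<Delta>)) [i..<i']"

text \<open>In \<open>adaptive_loop\<close>, \<open>ys\<close> holds the function values at the first \<open>b ^ m\<close> nodes; \<open>None\<close> stands
  for non-termination.\<close>

context
  fixes b :: nat and a :: "nat \<Rightarrow> nat^'d" and \<Delta> :: "real^'d" and kt :: "nat \<Rightarrow> int^'d"
    and \<omega>h \<omega>r :: "nat \<Rightarrow> real" and r :: nat and f :: "real^'d \<Rightarrow> complex" and \<epsilon> :: real
begin

partial_function (option) adaptive_loop :: "nat \<Rightarrow> complex list \<Rightarrow> complex run option" where
  "adaptive_loop m ys =
     (let test = comp_S_tilde b a kt (m - r) m ys \<triangleright> mulC (err_const \<omega>h \<omega>r r m) \<triangleright> (\<lambda>e. leqC e \<epsilon>)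
      in if result test
         then Some (test \<triangleright> (\<lambda>_. comp_cubature b m ys))
         else let new = sample b a \<Delta> f (b ^ m) (b ^ Suc m)
              in Option.bind (adaptive_loop (Suc m) (ys @ result new))
                   (\<lambda>rest. Some (test \<triangleright> (\<lambda>_. new) \<triangleright> (\<lambda>_. rest))))"

end

definition adaptive_algorithm ::
  "nat \<Rightarrow> (nat \<Rightarrow> nat^'d) \<Rightarrow> real^'d \<Rightarrow> (nat \<Rightarrow> int^'d) \<Rightarrow> (nat \<Rightarrow> real) \<Rightarrow> (nat \<Rightarrow> real) \<Rightarrow>
   nat \<Rightarrow> nat \<Rightarrow> (real^'d \<Rightarrow> complex) \<Rightarrow> real \<Rightarrow> complex run option" where
  "adaptive_algorithm b a \<Delta> kt \<omega>h \<omega>r ls r f \<epsilon> =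
     (let m = ls + r; init = sample b a \<Delta> f 0 (b ^ m)
      in Option.bind (adaptive_loop b a \<Delta> kt \<omega>h \<omega>r r f \<epsilon> m (result init))
           (\<lambda>rest. Some (init \<triangleright> (\<lambda>_. rest))))"

definition run_cost :: "real \<Rightarrow> 'a run \<Rightarrow> real" where
  "run_cost price p = price * real (evals p) + real (ops p)"

end

theory Submission
  imports Defs
begin

text \<open>Fourier inversion and the orthogonality of characters on the lattice give the aliasing
  formula: the discrete coefficient with index \<open>\<kappa> < b ^ m\<close> is the sum of the \<open>f\<close>-coefficients with
  indices \<open>\<kappa> + \<mu> * b ^ m\<close>, up to phases equal to \<open>1\<close> for \<open>\<mu> = 0\<close>.  Hence the cubature error is at most
  \<open>S_hat 0 m\<close>, and \<open>S_tilde (m - r) m\<close> differs from \<open>S_sum (m - r)\<close> by at most \<open>S_hat (m - r) m\<close>.  In the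
  cone, \<open>S_hat (m - r) m \<le> \<omega>h r * \<omega>r r * S_sum (m - r)\<close> with factor below \<open>1\<close>, so \<open>S_tilde\<close> controls
  \<open>S_sum\<close> from both sides: one side makes the stopping test reliable, the other gives \<open>m \<le> mstar\<close>.
  Each test costs \<open>O(m * b ^ m)\<close>, and the costs of all tests form a geometric sum.\<close>

section \<open>Fourier characters on the unit cube\<close>

text \<open>\<open>AC_integrands\<close> asks for summable Fourier coefficients, not that the series
  represents \<open>f\<close>. That is derived from uniqueness: the sum of the series is continuous
  and has the coefficients of \<open>f\<close>, and a continuous periodic function with zero
  coefficients vanishes. The other obstacle is the freedom in \<open>kt\<close>, which is specified
  only through wavenumbers and with digits possibly swapped at every level. What survives all
  choices is that \<open>wavenum b a m (kt n)\<close> depends only on \<open>n mod b ^ m\<close> and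
  separates these residues. This is what makes the frequencies aliased with
  \<open>kt \<kappa>\<close> exactly the progression \<open>\<kappa> + \<mu> * b ^ m\<close>. With
  \<open>q = \<omega>h r * \<omega>r r\<close>, the values \<open>S_tilde\<close> lie between
  \<open>(1 - q) * S_sum\<close> and \<open>(1 + q) * S_sum\<close>. The lower factor is the
  denominator of \<open>err_const\<close>, the upper one the factor in the definition of
  \<open>mstar\<close>. That \<open>mstar\<close> exists at all rests on \<open>S_sum\<close> being
  the blocks of a convergent series while \<omega>h stays bounded.\<close>

definition fchar :: "int^'d \<Rightarrow> real^'d \<Rightarrow> complex" where
  "fchar k x = cis (2 * pi * (\<Sum>j\<in>UNIV. real_of_int (k $ j) * x $ j))"

lemma fchar_0 [simp]: "fchar 0 x = 1"
  by (simp add: fchar_def)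

lemma fchar_add: "fchar (k + l) x = fchar k x * fchar l x"
  by (simp add: fchar_def cis_mult ring_distribs sum.distrib)

lemma fchar_add_right: "fchar k (x + y) = fchar k x * fchar k y"
  by (simp add: fchar_def cis_mult ring_distribs sum.distrib)

lemma norm_fchar [simp]: "norm (fchar k x) = 1"
  by (simp add: fchar_def)

lemma cis_eq_of_diff_Ints:
  assumes "x - y \<in> \<int>"
  shows "cis (2 * pi * x) = cis (2 * pi * y)"
proof -
  have "cis (2 * pi * (x - y)) = 1"
    using assms by (rule cis_multiple_2pi)
  then have "cis (2 * pi * y) * cis (2 * pi * (x - y)) = cis (2 * pi * y)"
    by simp
  then show ?thesis
    by (simp add: cis_mult ring_distribs)
qed

lemma cis_frac: "cis (2 * pi * frac x) = cis (2 * pi * x)"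
  by (rule cis_eq_of_diff_Ints) (simp add: frac_def)

text \<open>Integer frequencies do not see integer translations, so nodes and shifted nodes can be
  treated unreduced from here on.\<close>

lemma fchar_frac_vec: "fchar k (frac_vec x) = fchar k x"
  unfolding fchar_def
proof (rule cis_eq_of_diff_Ints)
  have "(\<Sum>j\<in>UNIV. real_of_int (k $ j) * frac_vec x $ j) - (\<Sum>j\<in>UNIV. real_of_int (k $ j) * x $ j) =
     (\<Sum>j\<in>UNIV. real_of_int (k $ j) * real_of_int (- \<lfloor>x $ j\<rfloor>))"
    by (simp add: frac_vec_def frac_def ring_distribs sum_subtractf sum_negf)
  also have "\<dots> \<in> \<int>"
    by (intro Ints_sum Ints_mult Ints_of_int)
  finally show "(\<Sum>j\<in>UNIV. real_of_int (k $ j) * frac_vec x $ j) - (\<Sum>j\<in>UNIV. real_of_int (k $ j) * x $ j) \<in> \<int>" .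
qed

text \<open>The reduction mod 1 in \<open>lpair\<close> is invisible to \<open>cis\<close>. The
  definition of \<open>fchar\<close> keeps the unreduced exponent because that one is linear in both
  arguments and continuous in \<open>x\<close>.\<close>

lemma fchar_lpair: "fchar k x = cis (2 * pi * lpair k x)"
  unfolding lpair_def fchar_def cis_frac ..

lemma exp_lpair: "exp (- 2 * of_real pi * \<i> * of_real (lpair k x)) = fchar (- k) x"
proof -
  have "exp (- 2 * of_real pi * \<i> * of_real (lpair k x)) = cis (- (2 * pi * lpair k x))"
    by (simp add: cis_conv_exp mult_ac)
  also have "\<dots> = cnj (fchar k x)"
    by (simp add: fchar_lpair cis_cnj)
  also have "\<dots> = fchar (- k) x"
    by (simp add: fchar_def cis_cnj sum_negf)
  finally show ?thesis .
qed

lemma continuous_on_fchar [continuous_intros]: "continuous_on A (fchar k)"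
  unfolding fchar_def by (intro continuous_intros)

lemma fourier_coeff_eq: "fourier_coeff f k = cube_integral (\<lambda>x. f x * fchar (- k) x)"
  by (simp only: fourier_coeff_def exp_lpair)

section \<open>Integration over the cube and orthogonality of characters\<close>

lemma unit_cube_borel [measurable]: "unit_cube \<in> sets borel"
  unfolding unit_cube_def by measurable

lemma unit_cube_subset: "unit_cube \<subseteq> cbox 0 (1 :: real^'d)"
  by (auto simp: unit_cube_def mem_box_cart less_imp_le)

lemma cube_integrable:
  fixes f :: "real^'d \<Rightarrow> 'b::{banach, second_countable_topology}"
  assumes "continuous_on UNIV f"
  shows "set_integrable lborel unit_cube f"
proof (rule set_integrable_subset)
  show "set_integrable lborel (cbox 0 1) f"
    unfolding set_integrable_def
    by (rule borel_integrable_compact) (auto intro: continuous_on_subset[OF assms])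
qed (use unit_cube_subset in auto)

lemma integral_exp_01:
  "(\<integral>t. indicator {0..<1} t *\<^sub>R cis (2 * pi * (of_int n * t)) \<partial>lborel) = (if n = 0 then 1 else 0)"
  "integrable lborel (\<lambda>t. indicator {0..<1} t *\<^sub>R cis (2 * pi * (of_int n * t)))"
proof -
  define h where "h = (\<lambda>t::real. cis (2 * pi * (of_int n * t)))"
  \<comment> \<open>An antiderivative of \<open>h\<close>; frequency 0 is separate because the
    general formula divides by \<open>n\<close>.\<close>
  define H where "H = (\<lambda>t::real. if n = 0 then complex_of_real t else cis (2 * pi * (of_int n * t)) / (2 * pi * \<i> * of_int n))"
  have c: "continuous_on {0..1} h"
    unfolding h_def by (intro continuous_intros)
  have d: "(H has_vector_derivative h t) (at t within {0..1})" for t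
  proof (cases "n = 0")
    case True
    then show ?thesis
      by (auto simp: H_def h_def intro!: derivative_eq_intros)
  next
    case False
    have "((\<lambda>t. exp (of_real t * (\<i> * (2 * pi * of_int n)))) has_vector_derivative
       (\<i> * (2 * pi * of_int n)) * exp (of_real t * (\<i> * (2 * pi * of_int n)))) (at t within {0..1})"
      using exp_scaleR_has_vector_derivative_right[of "\<i> * (2 * pi * of_int n)" t "{0..1}"]
      by (simp add: scaleR_conv_of_real mult_ac)
    from has_vector_derivative_divide[OF this, of "2 * pi * \<i> * of_int n"] False
    show ?thesis
      by (simp add: H_def h_def cis_conv_exp mult_ac)
  qed
  have 1: "has_bochner_integral lborel (\<lambda>t. indicator {0..1} t *\<^sub>R h t) (H 1 - H 0)"
    by (rule has_bochner_integral_FTC_Icc) (use c d in auto)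
  \<comment> \<open>The fundamental theorem gives the integral over the closed interval;
    \<open>unit_cube\<close> is half-open, and the two intervals differ by a null set.\<close>
  have ae: "AE t in lborel. indicator {0..1} t *\<^sub>R h t = indicator {0..<1} t *\<^sub>R h t"
    using AE_lborel_singleton[of "1::real"] by eventually_elim (auto simp: indicator_def)
  have "h \<in> borel_measurable borel"
    unfolding h_def by (intro borel_measurable_continuous_onI continuous_intros)
  then have 2: "has_bochner_integral lborel (\<lambda>t. indicator {0..<1} t *\<^sub>R h t) (H 1 - H 0)"
    using 1 by (subst has_bochner_integral_cong_AE[OF _ _ ae, symmetric]) auto
  have "cis (2 * pi * of_int n) = 1"
    by (rule cis_multiple_2pi) auto
  then have "H 1 - H 0 = (if n = 0 then 1 else 0)"
    by (simp add: H_def)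
  with 2 show "(\<integral>t. indicator {0..<1} t *\<^sub>R cis (2 * pi * (of_int n * t)) \<partial>lborel) = (if n = 0 then 1 else 0)"
    "integrable lborel (\<lambda>t. indicator {0..<1} t *\<^sub>R cis (2 * pi * (of_int n * t)))"
    by (auto simp: h_def has_bochner_integral_iff)
qed

lemma Basis_cart: "(Basis :: (real^'d) set) = (\<lambda>j. axis j 1) ` UNIV"
  by (auto simp: Basis_vec_def)

lemma prod_Basis_cart: "(\<Prod>b\<in>(Basis :: (real^'d) set). g b) = (\<Prod>j\<in>UNIV. g (axis j 1))"
  unfolding Basis_cart by (subst prod.reindex) (auto simp: inj_on_def axis_eq_axis)

text \<open>Fubini: the indicator of the cube and the character both factor over the coordinates,
  and one nonzero \<open>k $ j\<close> already makes the product of the one-dimensional integrals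
  vanish.\<close>

lemma cube_integral_fchar:
  fixes k :: "int^'d"
  shows "cube_integral (fchar k) = (if k = 0 then 1 else 0)"
proof -
  \<comment> \<open>The product measure behind \<open>lborel\<close> is indexed by
    \<open>Basis\<close> rather than by coordinates. This transports the frequencies to basis
    vectors; the floor only returns an integer from an already integral sum.\<close>
  define n where "n = (\<lambda>b::real^'d. \<lfloor>\<Sum>j\<in>UNIV. real_of_int (k $ j) * b $ j\<rfloor>)"
  have n: "n (axis j 1) = k $ j" for j
  proof -
    have "(\<Sum>i\<in>UNIV. real_of_int (k $ i) * axis j 1 $ i) = (\<Sum>i\<in>UNIV. if i = j then real_of_int (k $ i) else 0)"
      by (rule sum.cong) (auto simp: axis_def)
    then show ?thesis
      by (simp add: n_def)
  qed
  define h where "h = (\<lambda>(b::real^'d) t::real. indicator {0..<1} t *\<^sub>R cis (2 * pi * (of_int (n b) * t)))"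
  have "(\<lambda>t. cis (2 * pi * (of_int (n b) * t))) \<in> borel_measurable borel" for b
    by (intro borel_measurable_continuous_onI continuous_intros)
  then have h_meas [measurable]: "h b \<in> borel_measurable borel" for b
    unfolding h_def by measurable
  interpret product_sigma_finite "\<lambda>_::real^'d. lborel :: real measure"
    by (rule product_sigma_finite.intro) (rule sigma_finite_lborel)
  have eq: "indicator unit_cube x *\<^sub>R fchar k x = (\<Prod>b\<in>Basis. h b (x \<bullet> b))" for x :: "real^'d"
  proof -
    have "(\<Prod>j\<in>(UNIV::'d set). (if P j then c j else 0)) = (if \<forall>j. P j then \<Prod>j\<in>UNIV. c j else (0::complex))" for P c
      by auto
    note * = this
    have c: "(\<Prod>j\<in>A. cis (g j)) = cis (sum g A)" for g and A :: "'d set"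
      by (induction A rule: infinite_finite_induct) (auto simp: cis_mult)
    have "(\<Prod>b\<in>Basis. h b (x \<bullet> b)) = (\<Prod>j\<in>UNIV. h (axis j 1) (x $ j))"
      by (simp add: prod_Basis_cart inner_axis)
    also have "\<dots> = (\<Prod>j\<in>UNIV. if 0 \<le> x $ j \<and> x $ j < 1 then cis (2 * pi * (of_int (k $ j) * x $ j)) else 0)"
      by (rule prod.cong) (auto simp: h_def n indicator_def)
    also have "\<dots> = indicator unit_cube x *\<^sub>R fchar k x"
      unfolding * by (auto simp: unit_cube_def indicator_def fchar_def c sum_distrib_left)
    finally show ?thesis ..
  qed
  have "cube_integral (fchar k) = (\<integral>x. (\<Prod>b\<in>Basis. h b (x \<bullet> b)) \<partial>lborel)"
    unfolding cube_integral_def set_lebesgue_integral_def eq ..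
  also have "\<dots> = (\<integral>y. (\<Prod>b\<in>Basis. h b ((\<Sum>i\<in>Basis. y i *\<^sub>R i) \<bullet> b)) \<partial>(\<Pi>\<^sub>M b\<in>(Basis::(real^'d) set). lborel))"
    unfolding lborel_eq[where 'a="real^'d"]
    by (subst integral_distr) auto
  also have "\<dots> = (\<integral>y. (\<Prod>b\<in>Basis. h b (y b)) \<partial>(\<Pi>\<^sub>M b\<in>(Basis::(real^'d) set). lborel))"
    by (intro Bochner_Integration.integral_cong prod.cong refl) (simp add: inner_sum_left inner_Basis if_distrib sum.delta cong: if_cong)
  also have "\<dots> = (\<Prod>b\<in>Basis. \<integral>t. h b t \<partial>lborel)"
    by (rule product_integral_prod) (auto simp: h_def integral_exp_01)
  also have "\<dots> = (\<Prod>j\<in>UNIV. if k $ j = 0 then 1 else 0)"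
    by (simp add: h_def integral_exp_01 prod_Basis_cart n)
  also have "\<dots> = (if k = 0 then 1 else 0)"
    by (auto simp: vec_eq_iff)
  finally show ?thesis .
qed

section \<open>Fourier inversion\<close>

text \<open>Finite linear combinations of characters, generated inductively so that closure under
  products and vanishing of integrals follow by rule induction.\<close>

inductive trig_poly :: "(real^'d \<Rightarrow> complex) \<Rightarrow> bool" where
  trig_poly_char: "trig_poly (\<lambda>x. c * fchar k x)"
| trig_poly_add: "trig_poly p \<Longrightarrow> trig_poly q \<Longrightarrow> trig_poly (\<lambda>x. p x + q x)"

lemma trig_poly_const: "trig_poly (\<lambda>x. c)"
  using trig_poly_char[of c 0] by simp

lemma trig_poly_mult:
  assumes "trig_poly p" "trig_poly q"
  shows "trig_poly (\<lambda>x. p x * q x)"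
  using assms(1)
proof induction
  case (trig_poly_char c k)
  show ?case
    using assms(2)
  proof induction
    case (trig_poly_char c' k')
    have "(\<lambda>x. (c * fchar k x) * (c' * fchar k' x)) = (\<lambda>x. (c * c') * fchar (k + k') x)"
      by (simp add: fchar_add mult_ac)
    then show ?case
      by (simp add: trig_poly.trig_poly_char)
  next
    case (trig_poly_add p q)
    then show ?case
      using trig_poly.trig_poly_add by (simp add: distrib_left)
  qed
next
  case (trig_poly_add p q)
  then show ?case
    using trig_poly.trig_poly_add by (simp add: distrib_right)
qed

lemma trig_poly_power: "trig_poly p \<Longrightarrow> trig_poly (\<lambda>x. p x ^ n)"
  by (induction n) (simp_all add: trig_poly_const trig_poly_mult)

lemma trig_poly_sum: "finite A \<Longrightarrow> (\<And>i. i \<in> A \<Longrightarrow> trig_poly (p i)) \<Longrightarrow> trig_poly (\<lambda>x. \<Sum>i\<in>A. p i x)"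
  by (induction A rule: finite_induct) (simp_all add: trig_poly_const trig_poly_add)

text \<open>Euler's formula with the two frequencies \<open>axis j 1\<close> and
  \<open>axis j (- 1)\<close>; the translation by \<open>y\<close> goes into the
  coefficients.\<close>

lemma trig_poly_cos:
  fixes j :: "'d::finite"
  shows "trig_poly (\<lambda>x. of_real (cos (2 * pi * (x $ j - y))))"
proof -
  have "(\<Sum>i\<in>UNIV. real_of_int (axis j n $ i) * x $ i) = (\<Sum>i\<in>UNIV. if i = j then real_of_int n * x $ j else 0)" for x :: "real^'d" and n
    by (rule sum.cong) (auto simp: axis_def)
  then have ax: "fchar (axis j n) x = cis (2 * pi * (of_int n * x $ j))" for x :: "real^'d" and n
    by (simp add: fchar_def)
  have "complex_of_real (cos (2 * pi * (x $ j - y))) =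
      (cis (- 2 * pi * y) / 2) * fchar (axis j 1) x + (cis (2 * pi * y) / 2) * fchar (axis j (- 1)) x" for x :: "real^'d"
  proof -
    have "cis (- 2 * pi * y) * fchar (axis j 1) x = cis (2 * pi * (x $ j - y))"
      by (simp add: ax cis_mult algebra_simps)
    moreover have "cis (2 * pi * y) * fchar (axis j (- 1)) x = cis (- (2 * pi * (x $ j - y)))"
      by (simp add: ax cis_mult algebra_simps)
    ultimately show ?thesis
      by (simp add: complex_eq_iff)
  qed
  then show ?thesis
    by (simp only: trig_poly_char trig_poly_add)
qed

lemma continuous_on_trig_poly: "trig_poly p \<Longrightarrow> continuous_on A p"
  by (induction rule: trig_poly.induct) (intro continuous_intros; simp)+

lemma cube_integral_add:
  assumes "continuous_on UNIV f" "continuous_on UNIV g"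
  shows "cube_integral (\<lambda>x. f x + g x) = cube_integral f + cube_integral g"
  unfolding cube_integral_def
  by (intro set_integral_add cube_integrable assms)

lemma cube_integral_diff:
  assumes "continuous_on UNIV f" "continuous_on UNIV g"
  shows "cube_integral (\<lambda>x. f x - g x) = cube_integral f - cube_integral g"
  unfolding cube_integral_def
  by (intro set_integral_diff cube_integrable assms)

lemma cube_integral_cmult: "cube_integral (\<lambda>x. c * f x) = c * cube_integral f"
  unfolding cube_integral_def by simp

lemma cube_integral_trig_poly_eq_0:
  assumes "trig_poly p" "continuous_on UNIV g" "\<And>k. cube_integral (\<lambda>x. g x * fchar k x) = 0"
  shows "cube_integral (\<lambda>x. g x * p x) = 0"
  using assms(1)
proof induction
  case (trig_poly_char c k)
  then show ?case
    using assms(3)[of k] cube_integral_cmult[of c "\<lambda>x. g x * fchar k x"] by (simp add: mult_ac)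
next
  case (trig_poly_add p q)
  have "cube_integral (\<lambda>x. g x * p x + g x * q x) = 0"
    using trig_poly_add
    by (simp add: cube_integral_add continuous_on_mult[OF assms(2) continuous_on_trig_poly])
  then show ?case
    by (simp add: distrib_left)
qed

section \<open>Uniqueness of Fourier coefficients\<close>

lemma cube_measure_finite: "emeasure lborel (unit_cube :: (real^'d) set) < \<infinity>"
proof -
  have "emeasure lborel (unit_cube :: (real^'d) set) \<le> emeasure lborel (cbox 0 (1 :: real^'d))"
    by (rule emeasure_mono[OF unit_cube_subset]) simp
  also have "\<dots> < \<infinity>"
    by (rule emeasure_lborel_cbox_finite)
  finally show ?thesis .
qed

text \<open>A trigonometric polynomial which exceeds \<open>1\<close> exactly near \<open>x0\<close> has powers that
  concentrate there, so integrating against them detects the sign of \<open>Re (g x0)\<close>.\<close>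

lemma Re_nonpos_of_fourier_zero:
  fixes g :: "real^'d \<Rightarrow> complex"
  assumes g: "continuous_on UNIV g" and zero: "\<And>k. cube_integral (\<lambda>x. g x * fchar k x) = 0"
    and x0: "x0 \<in> box 0 1"
  shows "Re (g x0) \<le> 0"
proof (rule ccontr)
  assume "\<not> Re (g x0) \<le> 0"
  define c where "c = Re (g x0) / 2"
  have c: "c > 0" "Re (g x0) > c"
    using \<open>\<not> Re (g x0) \<le> 0\<close> by (auto simp: c_def)
  \<comment> \<open>A trigonometric substitute for the distance to \<open>x0\<close> modulo 1: it
    lies between 0 and 2 and vanishes exactly at the integer translates of
    \<open>x0\<close>.\<close>
  define D where "D = (\<lambda>x::real^'d. (\<Sum>j\<in>UNIV. 1 - cos (2 * pi * (x $ j - x0 $ j))) / CARD('d))"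
  have contD: "continuous_on A D" for A
    unfolding D_def by (intro continuous_intros) auto
  have D0: "D x \<ge> 0" for x
    unfolding D_def by (intro divide_nonneg_nonneg sum_nonneg) auto
  have D2: "D x \<le> 2" for x
  proof -
    have "(\<Sum>j\<in>UNIV. 1 - cos (2 * pi * (x $ j - x0 $ j))) \<le> (\<Sum>j\<in>(UNIV::'d set). 2)"
      by (rule sum_mono) (smt (verit) cos_ge_minus_one)
    then show ?thesis
      by (simp add: D_def field_simps)
  qed
  have D_eq_0: "x = x0" if "x \<in> cbox 0 1" "D x = 0" for x
  proof -
    have "1 - cos (2 * pi * (x $ j - x0 $ j)) = 0" for j
    proof -
      have "(\<Sum>j\<in>UNIV. 1 - cos (2 * pi * (x $ j - x0 $ j))) = 0"
        using \<open>D x = 0\<close> by (simp add: D_def)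
      then show ?thesis
        by (subst (asm) sum_nonneg_eq_0_iff) auto
    qed
    then have "\<exists>n::int. x $ j - x0 $ j = of_int n" for j
    proof -
      obtain n :: int where "2 * pi * (x $ j - x0 $ j) = of_int n * 2 * pi"
        using \<open>\<And>j. 1 - cos (2 * pi * (x $ j - x0 $ j)) = 0\<close>[of j]
        unfolding right_minus_eq eq_commute[of 1] cos_one_2pi_int by blast
      then have "(2 * pi) * (x $ j - x0 $ j) = (2 * pi) * of_int n"
        by (simp only: mult_ac)
      then show ?thesis
        by (subst (asm) mult_cancel_left) auto
    qed
    \<comment> \<open>Since \<open>x0\<close> is interior, even boundary points of the cube are
      closer than 1 to it in each coordinate, which leaves only the integer 0.\<close>
    moreover have "\<bar>x $ j - x0 $ j\<bar> < 1" for j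
    proof -
      have "0 \<le> x $ j" "x $ j \<le> 1" "0 < x0 $ j" "x0 $ j < 1"
        using that(1) x0 by (auto simp: mem_box_cart)
      then show ?thesis by linarith
    qed
    ultimately have "x $ j = x0 $ j" for j
      by (metis eq_iff_diff_eq_0 of_int_0 of_int_1 of_int_abs of_int_less_iff zabs_less_one_iff)
    then show ?thesis
      by (simp add: vec_eq_iff)
  qed
  \<comment> \<open>The part of the closed cube where \<open>Re (g x)\<close> is not above
    \<open>c\<close>. It is compact and misses \<open>x0\<close>, so \<open>D\<close> is bounded
    below on it by some \<gamma> > 0.\<close>
  define K where "K = cbox 0 1 \<inter> {x. Re (g x) \<le> c}"
  have "closed {x. Re (g x) \<le> c}"
    by (intro closed_Collect_le continuous_intros g)
  then have "compact K"
    unfolding K_def by (intro compact_Int_closed compact_cbox)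
  have "\<exists>\<gamma>>0. \<gamma> \<le> 1 \<and> (\<forall>x\<in>K. \<gamma> \<le> D x)"
  proof (cases "K = {}")
    case True
    then show ?thesis by (auto intro: exI[of _ 1])
  next
    case False
    obtain y where y: "y \<in> K" "\<forall>x\<in>K. D y \<le> D x"
      using continuous_attains_inf[OF \<open>compact K\<close> False contD] by blast
    have "D y \<noteq> 0"
      using D_eq_0[of y] y(1) c(2) by (auto simp: K_def)
    then have "D y > 0"
      using D0[of y] by linarith
    then show ?thesis
      using y(2) by (intro exI[of _ "min (D y) 1"]) auto
  qed
  then obtain \<gamma> where \<gamma>: "\<gamma> > 0" "\<gamma> \<le> 1" "\<And>x. x \<in> K \<Longrightarrow> \<gamma> \<le> D x"
    by blast
  \<comment> \<open>Half of the gap \<gamma>: on \<open>K\<close> it gives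
    \<open>P x \<le> 1 - \<eta>\<close>, and \<open>D x \<le> 2\<close> gives
    \<open>P x \<ge> \<eta> - 1\<close> everywhere. Where \<open>D x < \<eta> / 2\<close>, in
    contrast, \<open>P x\<close> exceeds \<open>1 + \<eta> / 2\<close>.\<close>
  define \<eta> where "\<eta> = \<gamma> / 2"
  define P where "P = (\<lambda>x. 1 + \<eta> - D x)"
  have contP: "continuous_on A P" for A
    unfolding P_def by (intro continuous_intros contD)
  have "x0 \<in> {x. D x < \<eta> / 2} \<inter> box 0 1"
    using x0 \<gamma>(1) by (simp add: D_def \<eta>_def)
  moreover have "open ({x. D x < \<eta> / 2} \<inter> box 0 1)"
    by (intro open_Int open_Collect_less contD continuous_intros) auto
  ultimately obtain e where e: "e > 0" "ball x0 e \<subseteq> {x. D x < \<eta> / 2} \<inter> box 0 1"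
    using open_contains_ball_eq by blast
  have "bounded (g ` cbox 0 1)"
    by (intro compact_imp_bounded compact_continuous_image continuous_on_subset[OF g]) auto
  then obtain M where M: "\<And>x. x \<in> cbox 0 1 \<Longrightarrow> norm (g x) \<le> M"
    by (auto simp: bounded_iff)
  have "0 \<le> M"
    using M[of x0] x0 box_subset_cbox[of 0 "1::real^'d"] norm_ge_zero[of "g x0"] by (meson order_trans subsetD)
  have small: "- M \<le> Re (g x) * P x ^ n" if "x \<in> unit_cube" "\<bar>P x\<bar> \<le> 1" for x n
  proof -
    have "\<bar>P x ^ n\<bar> \<le> 1"
      using that(2) by (simp add: power_abs power_le_one)
    moreover have "\<bar>Re (g x)\<bar> \<le> M"
      using M[of x] that(1) unit_cube_subset abs_Re_le_cmod[of "g x"] by force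
    ultimately have "\<bar>Re (g x) * P x ^ n\<bar> \<le> M * 1"
      unfolding abs_mult using \<open>0 \<le> M\<close> by (intro mult_mono) auto
    then show ?thesis
      by (simp add: abs_le_iff)
  qed
  \<comment> \<open>Off the ball the integrand may be negative, but never below \<open>- M\<close>:
    on \<open>K\<close> and wherever \<open>P x < 0\<close> one has
    \<open>\<bar>P x\<bar> \<le> 1\<close>, and at the remaining points both factors are
    nonnegative.\<close>
  have lower: "c * (1 + \<eta> / 2) ^ n * indicator (ball x0 e) x - M \<le> Re (g x) * P x ^ n"
    if x: "x \<in> unit_cube" for x n
  proof (cases "x \<in> ball x0 e")
    case True
    then have D: "D x < \<eta> / 2"
      using e(2) by auto
    then have "x \<notin> K"
      using \<gamma>(1) \<gamma>(3)[of x] by (auto simp: \<eta>_def)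
    then have gx: "Re (g x) > c"
      using x unit_cube_subset by (auto simp: K_def)
    have "1 + \<eta> / 2 \<le> P x"
      using D by (simp add: P_def)
    then have "c * (1 + \<eta> / 2) ^ n \<le> Re (g x) * P x ^ n"
      using gx c \<gamma>(1) by (intro mult_mono power_mono) (auto simp: \<eta>_def)
    then show ?thesis
      using True \<open>0 \<le> M\<close> by simp
  next
    case out: False
    have "- M \<le> Re (g x) * P x ^ n"
    proof (cases "x \<in> K")
      case True
      then have "\<gamma> \<le> D x"
        by (rule \<gamma>(3))
      then have "\<bar>P x\<bar> \<le> 1"
        using D2[of x] \<gamma>(1) by (auto simp: P_def \<eta>_def abs_if)
      with x show ?thesis
        by (rule small)
    next
      case False
      then have gx: "Re (g x) > c"
        using x unit_cube_subset by (auto simp: K_def)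
      show ?thesis
      proof (cases "0 \<le> P x")
        case True
        then have "0 \<le> Re (g x) * P x ^ n"
          using gx c by (intro mult_nonneg_nonneg) auto
        then show ?thesis
          using \<open>0 \<le> M\<close> by simp
      next
        case False
        then have "\<bar>P x\<bar> \<le> 1"
          using D2[of x] \<gamma>(1) by (auto simp: P_def \<eta>_def abs_if)
        with x show ?thesis
          by (rule small)
      qed
    qed
    then show ?thesis
      using out by simp
  qed
  \<comment> \<open>\<open>P\<close> is respelled with sums and products only, the shape that the
    closure rules match.\<close>
  have "trig_poly (\<lambda>x. (of_real (1 + \<eta>) + (\<Sum>j\<in>UNIV. - (1 / of_nat CARD('d)) * (1 + (- 1) * of_real (cos (2 * pi * (x $ j - x0 $ j)))))) ^ n)" for n
    by (intro trig_poly_power trig_poly_add trig_poly_mult trig_poly_const trig_poly_sum trig_poly_cos) auto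
  moreover have "of_real (1 + \<eta>) + (\<Sum>j\<in>UNIV. - (1 / of_nat CARD('d)) * (1 + (- 1) * of_real (cos (2 * pi * (x $ j - x0 $ j))))) = complex_of_real (P x)" for x
    by (simp add: P_def D_def sum_distrib_left sum_divide_distrib sum_negf diff_divide_distrib sum_subtractf)
  ultimately have trigP: "trig_poly (\<lambda>x. of_real (P x) ^ n)" for n
    by simp
  have int_ball: "set_integrable lborel unit_cube (indicator (ball x0 e) :: _ \<Rightarrow> real)"
    unfolding set_integrable_def real_scaleR_def indicator_inter_arith[symmetric]
    by (rule integrable_real_indicator, simp, rule le_less_trans[OF emeasure_mono cube_measure_finite]) auto
  have ball_sub: "ball x0 e \<subseteq> unit_cube"
  proof -
    have "box 0 (1::real^'d) \<subseteq> unit_cube"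
      by (auto simp: unit_cube_def mem_box_cart less_imp_le)
    then show ?thesis
      using e(2) by blast
  qed
  define V where "V = measure lborel (ball x0 e)"
  have "V > 0"
    unfolding V_def using e(1) content_ball_pos by blast
  define U where "U = measure lborel (unit_cube :: (real^'d) set)"
  \<comment> \<open>The integral of \<open>g * P ^ n\<close> is 0 for every \<open>n\<close>,
    whereas its lower bound grows exponentially with \<open>n\<close> on the ball and loses at most
    \<open>M * U\<close> elsewhere.\<close>
  have bound: "c * (1 + \<eta> / 2) ^ n * V \<le> M * U" for n
  proof -
    have cont: "continuous_on UNIV (\<lambda>x. g x * of_real (P x) ^ n)"
      by (intro continuous_intros g contP)
    have "0 = Re (cube_integral (\<lambda>x. g x * of_real (P x) ^ n))"
      using cube_integral_trig_poly_eq_0[OF trigP g zero, of n] by simp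
    also have "\<dots> = (LINT x:unit_cube|lborel. Re (g x * of_real (P x) ^ n))"
      using cube_integrable[OF cont]
      unfolding cube_integral_def set_lebesgue_integral_def set_integrable_def
      by (subst integral_Re[symmetric]) auto
    also have "\<dots> = (LINT x:unit_cube|lborel. Re (g x) * P x ^ n)"
      by (simp flip: of_real_power)
    finally have 1: "(LINT x:unit_cube|lborel. Re (g x) * P x ^ n) = 0" by simp
    have one: "set_integrable lborel unit_cube (\<lambda>x::real^'d. M)"
      by (rule cube_integrable) simp
    have "(LINT x:unit_cube|lborel. c * (1 + \<eta> / 2) ^ n * indicator (ball x0 e) x - M) \<le>
       (LINT x:unit_cube|lborel. Re (g x) * P x ^ n)"
      by (intro set_integral_mono set_integral_diff set_integrable_mult_right int_ball one lower cube_integrable continuous_intros g contP)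
    moreover have "(LINT x:unit_cube|lborel. c * (1 + \<eta> / 2) ^ n * indicator (ball x0 e) x - M) =
       c * (1 + \<eta> / 2) ^ n * V - M * U"
    proof -
      have "(LINT x:unit_cube|lborel. indicator (ball x0 e) x) = V"
        unfolding set_lebesgue_integral_def real_scaleR_def indicator_inter_arith[symmetric] V_def
        using ball_sub by (simp add: Int_absorb1)
      moreover have "(LINT x:(unit_cube::(real^'d) set)|lborel. M) = M * U"
        unfolding U_def using cube_measure_finite[where 'd='d] by (subst set_integral_const) auto
      ultimately show ?thesis
        by (subst set_integral_diff) (auto intro!: int_ball one)
    qed
    ultimately show ?thesis
      using 1 by linarith
  qed
  obtain n where "M * U / (c * V) < (1 + \<eta> / 2) ^ n"
    using real_arch_pow[of "1 + \<eta> / 2"] \<gamma>(1) by (auto simp: \<eta>_def)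
  then have "M * U < c * (1 + \<eta> / 2) ^ n * V"
    using c(1) \<open>V > 0\<close> by (simp add: field_simps)
  with bound[of n] show False by linarith
qed

text \<open>Multiplying \<open>g\<close> by \<open>cnj (g y)\<close> makes the real part at
  \<open>y\<close> equal to the squared modulus of \<open>g y\<close>, so the sign test kills it.
  Continuity extends this from the open cube to its closure, periodicity to the whole space.\<close>

lemma eq_0_of_fourier_zero:
  fixes g :: "real^'d \<Rightarrow> complex"
  assumes g: "continuous_on UNIV g" and zero: "\<And>k. cube_integral (\<lambda>x. g x * fchar k x) = 0"
    and periodic: "\<And>x k. g (x + (\<chi> j. real_of_int (k $ j))) = g x"
  shows "g x = 0"
proof -
  have "g y = 0" if "y \<in> box 0 1" for y
  proof -
    have "Re (cnj (g y) * g y) \<le> 0"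
    proof (rule Re_nonpos_of_fourier_zero[of "\<lambda>x. cnj (g y) * g x" y, OF _ _ that])
      show "continuous_on UNIV (\<lambda>x. cnj (g y) * g x)"
        by (intro continuous_intros g)
      show "cube_integral (\<lambda>x. cnj (g y) * g x * fchar k x) = 0" for k
        using zero[of k] cube_integral_cmult[of "cnj (g y)" "\<lambda>x. g x * fchar k x"] by (simp add: mult.assoc)
    qed
    then show ?thesis
      by (simp add: complex_eq_iff sum_squares_le_zero_iff)
  qed
  moreover have "frac_vec x \<in> closure (box 0 1)"
  proof -
    have "box 0 (1 :: real^'d) \<noteq> {}"
      by (simp add: interval_ne_empty_cart)
    then show ?thesis
      by (subst closure_box) (auto simp: mem_box_cart frac_vec_def frac_lt_1 less_imp_le)
  qed
  ultimately have "g (frac_vec x) = 0"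
    using continuous_constant_on_closure[of "box 0 1" g 0] continuous_on_subset[OF g] by blast
  moreover have "frac_vec x + (\<chi> j. real_of_int ((\<chi> j. \<lfloor>x $ j\<rfloor>) $ j)) = x"
    by (simp add: vec_eq_iff frac_vec_def frac_def)
  ultimately show ?thesis
    using periodic[of "frac_vec x" "\<chi> j. \<lfloor>x $ j\<rfloor>"] by simp
qed

section \<open>Inversion of absolutely convergent Fourier series\<close>

lemma fchar_periodic: "fchar k (x + (\<chi> j. real_of_int (l $ j))) = fchar k x"
  unfolding fchar_def
  by (rule cis_eq_of_diff_Ints) (auto simp: ring_distribs sum.distrib intro!: Ints_sum)

text \<open>Absolute summability of \<open>c\<close> permits integration term by term; by
  orthogonality and injectivity of \<open>kt\<close> only the term \<open>n = m\<close>
  remains.\<close>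

lemma cube_integral_fourier_series:
  fixes kt :: "nat \<Rightarrow> int^'d"
  assumes kt: "bij kt" and c: "summable (\<lambda>n. norm (c n))"
  shows "cube_integral (\<lambda>x. (\<Sum>n. c n * fchar (kt n) x) * fchar (- kt m) x) = c m"
proof -
  define h where "h = (\<lambda>n x. indicator unit_cube x *\<^sub>R (c n * fchar (kt n - kt m) x))"
  have int: "integrable lborel (h n)" for n
    unfolding h_def by (rule cube_integrable[unfolded set_integrable_def]) (intro continuous_intros)
  have summ: "summable (\<lambda>n. norm (c n * fchar k x))" for x k
    using c by (simp add: norm_mult)
  have "summable (\<lambda>n. c n * fchar (kt n) x)" for x
    by (rule summable_norm_cancel) (use c in \<open>simp add: norm_mult\<close>)
  then have eq: "indicator unit_cube x *\<^sub>R ((\<Sum>n. c n * fchar (kt n) x) * fchar (- kt m) x) = (\<Sum>n. h n x)" for x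
    by (simp add: h_def fchar_add mult.assoc[symmetric] suminf_mult2 suminf_scaleR_right summable_mult2
        diff_conv_add_uminus del: add_uminus_conv_diff)
  have "cube_integral (\<lambda>x. (\<Sum>n. c n * fchar (kt n) x) * fchar (- kt m) x) = (\<integral>x. (\<Sum>n. h n x) \<partial>lborel)"
    unfolding cube_integral_def set_lebesgue_integral_def eq ..
  also have "\<dots> = (\<Sum>n. \<integral>x. h n x \<partial>lborel)"
  proof (rule integral_suminf[OF int])
    show "AE x in lborel. summable (\<lambda>i. norm (h i x))"
      using c by (auto simp: h_def norm_mult intro!: AE_I2 summable_mult)
    have "(\<integral>x. norm (h n x) \<partial>lborel) = norm (c n) * measure lborel (unit_cube :: (real^'d) set)" for n
      using cube_measure_finite by (simp add: h_def norm_mult mult.commute)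
    then show "summable (\<lambda>i. \<integral>x. norm (h i x) \<partial>lborel)"
      using c by (simp add: summable_mult2)
  qed
  also have "(\<lambda>n. \<integral>x. h n x \<partial>lborel) = (\<lambda>n. if n = m then c n else 0)"
  proof
    fix n
    have "(\<integral>x. h n x \<partial>lborel) = cube_integral (\<lambda>x. c n * fchar (kt n - kt m) x)"
      by (simp only: h_def cube_integral_def set_lebesgue_integral_def)
    also have "\<dots> = (if n = m then c n else 0)"
      using kt by (auto simp: cube_integral_cmult cube_integral_fchar bij_def inj_eq)
    finally show "(\<integral>x. h n x \<partial>lborel) = (if n = m then c n else 0)" .
  qed
  also have "(\<Sum>n. if n = m then c n else 0) = c m"
    using sums_single[of m c] by (simp add: sums_iff)
  finally show ?thesis .
qed

lemma fourier_inversion: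
  fixes f :: "real^'d \<Rightarrow> complex"
  assumes f: "continuous_on UNIV f" and periodic: "\<And>x k. f (x + (\<chi> j. real_of_int (k $ j))) = f x"
    and kt: "bij kt" and summable: "summable (\<lambda>n. norm (fourier_coeff f (kt n)))"
  shows "((\<lambda>n. fourier_coeff f (kt n) * fchar (kt n) x) has_sum f x) UNIV"
proof -
  define c where "c = (\<lambda>n. fourier_coeff f (kt n))"
  define F where "F = (\<lambda>x. \<Sum>n. c n * fchar (kt n) x)"
  have "uniform_limit UNIV (\<lambda>n x. \<Sum>i<n. c i * fchar (kt i) x) F sequentially"
    unfolding F_def by (rule Weierstrass_m_test) (use summable in \<open>auto simp: norm_mult c_def\<close>)
  then have F: "continuous_on UNIV F"
    by (rule uniform_limit_theorem[rotated]) (auto intro!: always_eventually continuous_intros)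
  have "f x - F x = 0"
  proof (rule eq_0_of_fourier_zero)
    show "continuous_on UNIV (\<lambda>x. f x - F x)"
      by (intro continuous_intros f F)
    show "f (x + (\<chi> j. real_of_int (k $ j))) - F (x + (\<chi> j. real_of_int (k $ j))) = f x - F x" for x k
      by (simp add: periodic F_def fchar_periodic)
    fix k
    \<comment> \<open>Coefficients pair with \<open>fchar (- k)\<close>, so it is \<open>- k\<close>
      that must be hit by the surjection \<open>kt\<close>.\<close>
    obtain m where m: "- k = kt m"
      using kt by (metis bij_pointE)
    then have k: "k = - kt m"
      by (metis minus_minus)
    have "cube_integral (\<lambda>x. (f x - F x) * fchar k x) =
        cube_integral (\<lambda>x. f x * fchar k x) - cube_integral (\<lambda>x. F x * fchar k x)"
      unfolding left_diff_distrib by (intro cube_integral_diff continuous_intros f F)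
    also have "cube_integral (\<lambda>x. F x * fchar k x) = c m"
      unfolding F_def k by (rule cube_integral_fourier_series[OF kt]) (use summable in \<open>simp add: c_def\<close>)
    finally show "cube_integral (\<lambda>x. (f x - F x) * fchar k x) = 0"
      by (simp add: c_def fourier_coeff_eq k)
  qed
  then have "f x = F x" by simp
  moreover have s: "summable (\<lambda>n. norm (c n * fchar (kt n) x))"
    using summable by (simp add: norm_mult c_def)
  ultimately have "(\<lambda>n. c n * fchar (kt n) x) sums f x"
    unfolding F_def by (simp add: summable_norm_cancel summable_sums)
  with s show ?thesis
    unfolding c_def by (rule norm_summable_imp_has_sum)
qed

section \<open>Wavenumbers and characters on the lattice\<close>

lemma lpair_z_pow: 
  assumes "b > 0"
  shows "lpair k (z_pow b a m) = real (wavenum b a (Suc m) k) / real (b ^ Suc m)"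
  using wavenum_Suc_real[OF assms, of a m k] assms by (simp add: field_simps)

lemma wavenum_less:
  assumes "b > 0"
  shows "wavenum b a m k < b ^ m"
proof (cases m)
  case 0
  then show ?thesis by (simp add: wavenum_def)
next
  case (Suc n)
  have "lpair k (z_pow b a n) < 1"
    by (simp add: lpair_def frac_lt_1)
  then have "real (wavenum b a (Suc n) k) < real (b ^ Suc n)"
    unfolding lpair_z_pow[OF assms] using assms by (simp add: field_simps)
  then show ?thesis
    unfolding Suc of_nat_less_iff .
qed

text \<open>The node recursion says that \<open>b * z_pow b a (Suc n)\<close> is
  \<open>z_pow b a n\<close> plus an integer vector. Paired with the integer vector
  \<open>k\<close>, the second summand contributes an integer \<open>t\<close>, which the scaling
  turns into a multiple of \<open>b ^ Suc n\<close>.\<close>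

lemma wavenum_Suc_mod:
  assumes "b > 0"
  shows "wavenum b a (Suc m) k mod b ^ m = wavenum b a m k"
proof (cases m)
  case 0
  then show ?thesis by (simp add: wavenum_def)
next
  case (Suc n)
  define s where "s = (\<lambda>m. \<Sum>j\<in>UNIV. real_of_int (k $ j) * z_pow b a m $ j)"
  define t where "t = (\<Sum>j\<in>UNIV. k $ j * int (a (Suc n) $ j))"
  have "real b * s (Suc n) = (\<Sum>j\<in>UNIV. real_of_int (k $ j) * (z_pow b a n $ j + real (a (Suc n) $ j)))"
    unfolding s_def sum_distrib_left using assms by (intro sum.cong) auto
  then have s: "real b * s (Suc n) = s n + of_int t"
    by (simp add: s_def t_def ring_distribs sum.distrib)
  have 1: "real (wavenum b a (Suc n) k) = real (b ^ Suc n) * (s n - of_int \<lfloor>s n\<rfloor>)"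
    unfolding wavenum_Suc_real[OF assms] lpair_def s_def frac_def ..
  have 2: "real (wavenum b a (Suc (Suc n)) k) = real (b ^ Suc n) * (real b * s (Suc n) - real b * of_int \<lfloor>s (Suc n)\<rfloor>)"
    unfolding wavenum_Suc_real[OF assms] lpair_def s_def frac_def by (simp add: algebra_simps)
  \<comment> \<open>Collects \<open>t\<close> and the two integer parts removed by
    \<open>frac\<close>; only its integrality matters.\<close>
  define q where "q = t + \<lfloor>s n\<rfloor> - int b * \<lfloor>s (Suc n)\<rfloor>"
  have "real_of_int (int (wavenum b a (Suc (Suc n)) k)) = of_int (int (wavenum b a (Suc n) k) + int (b ^ Suc n) * q)"
    using 1 2 unfolding s q_def by (simp add: algebra_simps)
  then have "int (wavenum b a (Suc (Suc n)) k) = int (wavenum b a (Suc n) k) + int (b ^ Suc n) * q"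
    by (simp only: of_int_eq_iff)
  then have "int (wavenum b a (Suc (Suc n)) k) mod int (b ^ Suc n) = int (wavenum b a (Suc n) k) mod int (b ^ Suc n)"
    by simp
  then show ?thesis
    unfolding Suc zmod_int[symmetric] of_nat_eq_iff using wavenum_less[OF assms, of a "Suc n" k] by simp
qed

lemma wavenum_mod:
  assumes "b > 0" "m \<le> n"
  shows "wavenum b a n k mod b ^ m = wavenum b a m k"
  using assms(2)
proof (induction n rule: dec_induct)
  case base
  then show ?case using wavenum_less[OF assms(1), of a m k] by simp
next
  case (step n)
  have "wavenum b a (Suc n) k mod b ^ m = wavenum b a (Suc n) k mod b ^ n mod b ^ m"
    using step.hyps by (simp add: mod_mod_cancel le_imp_power_dvd)
  then show ?case
    using step.IH wavenum_Suc_mod[OF assms(1), of a n k] by simp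
qed

text \<open>\<open>wavenum\<close> is additive only modulo \<open>b ^ m\<close>, so fractional parts
  are compared instead. This turns the orthogonality condition on a difference of frequencies into
  equality of wavenumbers.\<close>

lemma wavenum_diff_eq_0_iff:
  fixes k l :: "int^'d"
  assumes "b > 0"
  shows "wavenum b a m (k - l) = 0 \<longleftrightarrow> wavenum b a m k = wavenum b a m l"
proof (cases m)
  case 0
  then show ?thesis by (simp add: wavenum_def)
next
  case (Suc n)
  define s where "s = (\<lambda>k::int^'d. \<Sum>j\<in>UNIV. real_of_int (k $ j) * z_pow b a n $ j)"
  have s: "s (k - l) = s k - s l"
    by (simp add: s_def left_diff_distrib sum_subtractf)
  have w: "wavenum b a m k = wavenum b a m l \<longleftrightarrow> frac (s k) = frac (s l)" for k l
  proof -
    have "wavenum b a m k = wavenum b a m l \<longleftrightarrow> real (wavenum b a m k) = real (wavenum b a m l)"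
      by simp
    then show ?thesis
      unfolding Suc wavenum_Suc_real[OF assms] lpair_def s_def using assms by simp
  qed
  have "wavenum b a m 0 = 0"
    by (simp add: wavenum_def lpair_def split: nat.split)
  moreover have "s 0 = 0"
    by (simp add: s_def)
  ultimately have "wavenum b a m (k - l) = 0 \<longleftrightarrow> frac (s k - s l) = 0"
    using w[of "k - l" 0] by (simp add: s)
  also have "\<dots> \<longleftrightarrow> frac (s k) = frac (s l)"
  proof
    assume "frac (s k - s l) = 0"
    then obtain z :: int where "s k - s l = of_int z"
      by (metis Ints_cases frac_eq_0_iff)
    then have "s k = s l + of_int z"
      by simp
    then show "frac (s k) = frac (s l)"
      by (simp add: frac_def)
  next
    assume "frac (s k) = frac (s l)"
    then have "s k - s l = of_int (\<lfloor>s k\<rfloor> - \<lfloor>s l\<rfloor>)"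
      by (simp add: frac_def)
    then show "frac (s k - s l) = 0"
      by (metis Ints_of_int frac_eq_0_iff)
  qed
  finally show ?thesis
    using w[of k l] by simp
qed

section \<open>Digit expansions and character sums over the nodes\<close>

lemma fchar_z_node:
  assumes "b > 1" "i < b ^ m"
  shows "fchar k (z_node b a i) = (\<Prod>t<m. cis (2 * pi * (real (i div b ^ t mod b) * (real (wavenum b a (Suc t) k) / real (b ^ Suc t)))))"
proof -
  have "i < b ^ i"
    using assms(1) by (simp add: power_gt_expt)
  have vanish: "i div b ^ l mod b = 0" if "i < b ^ l" for l
    using that by simp
  \<comment> \<open>Neither \<open>i\<close> nor \<open>m\<close> need bound the other, so both
    index ranges are compared with their union; the digits of \<open>i\<close> vanish from position
    \<open>i\<close> on and from position \<open>m\<close> on.\<close>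
  have "(\<Sum>l\<le>i. real (i div b ^ l mod b) *\<^sub>R z_pow b a l) = (\<Sum>l\<in>{..i} \<union> {..<m}. real (i div b ^ l mod b) *\<^sub>R z_pow b a l)"
  proof (rule sum.mono_neutral_left)
    show "\<forall>l\<in>{..i} \<union> {..<m} - {..i}. real (i div b ^ l mod b) *\<^sub>R z_pow b a l = 0"
    proof
      fix l assume "l \<in> {..i} \<union> {..<m} - {..i}"
      then have "b ^ i \<le> b ^ l" using assms(1) by (intro power_increasing) auto
      then show "real (i div b ^ l mod b) *\<^sub>R z_pow b a l = 0"
        using \<open>i < b ^ i\<close> vanish[of l] by simp
    qed
  qed auto
  also have "\<dots> = (\<Sum>l<m. real (i div b ^ l mod b) *\<^sub>R z_pow b a l)"
  proof (rule sum.mono_neutral_right)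
    show "\<forall>l\<in>{..i} \<union> {..<m} - {..<m}. real (i div b ^ l mod b) *\<^sub>R z_pow b a l = 0"
    proof
      fix l assume "l \<in> {..i} \<union> {..<m} - {..<m}"
      then have "b ^ m \<le> b ^ l" using assms(1) by (intro power_increasing) auto
      then show "real (i div b ^ l mod b) *\<^sub>R z_pow b a l = 0"
        using assms(2) vanish[of l] by simp
    qed
  qed auto
  finally have node: "z_node b a i = frac_vec (\<Sum>l<m. real (i div b ^ l mod b) *\<^sub>R z_pow b a l)"
    by (simp add: z_node_def)
  have sum: "fchar k (\<Sum>l\<in>A. x l) = (\<Prod>l\<in>A. fchar k (x l))" for x and A :: "nat set"
    by (induction A rule: infinite_finite_induct) (auto simp: fchar_add_right, auto simp: fchar_def)
  have scale: "fchar k (real n *\<^sub>R x) = cis (2 * pi * (real n * lpair k x))" for n x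
  proof -
    have "fchar k (real n *\<^sub>R x) = fchar k x ^ n"
      by (simp add: fchar_def Complex.DeMoivre sum_distrib_left mult_ac)
    then show ?thesis
      by (simp add: fchar_lpair Complex.DeMoivre mult_ac)
  qed
  show ?thesis
    unfolding node fchar_frac_vec sum scale using assms(1) by (simp only: lpair_z_pow)
qed

lemma sum_digits_split:
  fixes F :: "nat \<Rightarrow> 'b::comm_monoid_add"
  assumes "b > 0"
  shows "(\<Sum>i<b ^ Suc m. F i) = (\<Sum>j<b. \<Sum>i<b ^ m. F (i + j * b ^ m))"
proof -
  have "(\<Sum>j<b. \<Sum>i<b ^ m. F (i + j * b ^ m)) = (\<Sum>(j, i)\<in>{..<b} \<times> {..<b ^ m}. F (i + j * b ^ m))"
    by (rule sum.cartesian_product)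
  also have "\<dots> = (\<Sum>i<b ^ Suc m. F i)"
  proof (rule sum.reindex_bij_witness[of _ "\<lambda>i. (i div b ^ m, i mod b ^ m)" "\<lambda>(j, i). i + j * b ^ m"])
    fix p assume "p \<in> {..<b} \<times> {..<b ^ m}"
    then obtain j i where p: "p = (j, i)" "j < b" "i < b ^ m" by auto
    have "i + j * b ^ m < (j + 1) * b ^ m" using p by simp
    also have "\<dots> \<le> b * b ^ m" using p by (intro mult_right_mono) auto
    finally show "(case p of (j, i) \<Rightarrow> i + j * b ^ m) \<in> {..<b ^ Suc m}"
      using p by simp
  qed (use assms in \<open>auto simp: less_mult_imp_div_less mult_ac\<close>)
  finally show ?thesis ..
qed

lemma digit_add:
  fixes i j b m t :: nat
  assumes "t < m" "b > 0"
  shows "(i + j * b ^ m) div b ^ t mod b = i div b ^ t mod b"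
proof -
  \<comment> \<open>The \<open>Suc\<close> exposes the factor \<open>b\<close> that
    \<open>j * b ^ m\<close> retains after division by \<open>b ^ t\<close>; this factor makes it
    vanish modulo \<open>b\<close>.\<close>
  obtain s where m: "m = Suc (t + s)"
    using less_imp_Suc_add[OF assms(1)] by auto
  have eq: "i + j * b ^ m = i + j * b ^ s * b * b ^ t"
    by (simp add: m power_add)
  have "b ^ t \<noteq> 0"
    using assms(2) by simp
  from div_mult_self1[OF this, of i "j * b ^ s * b"] show ?thesis
    unfolding eq by (simp only: mod_mult_self3)
qed

text \<open>Distributivity, with \<open>i\<close> running through all digit tuples; the induction
  peels off the top digit.\<close>

lemma sum_prod_digits:
  fixes g :: "nat \<Rightarrow> nat \<Rightarrow> 'b::comm_semiring_1"
  assumes "b > 0"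
  shows "(\<Sum>i<b ^ m. \<Prod>t<m. g t (i div b ^ t mod b)) = (\<Prod>t<m. \<Sum>j<b. g t j)"
proof (induction m)
  case (Suc m)
  have "(\<Sum>i<b ^ Suc m. \<Prod>t<Suc m. g t (i div b ^ t mod b)) =
      (\<Sum>j<b. \<Sum>i<b ^ m. \<Prod>t<Suc m. g t ((i + j * b ^ m) div b ^ t mod b))"
    by (rule sum_digits_split[OF assms])
  also have "\<dots> = (\<Sum>j<b. \<Sum>i<b ^ m. (\<Prod>t<m. g t (i div b ^ t mod b)) * g m j)"
    using assms by (intro sum.cong refl) (simp add: digit_add)
  also have "\<dots> = (\<Prod>t<Suc m. \<Sum>j<b. g t j)"
    by (simp add: sum_distrib_left[symmetric] sum_distrib_right[symmetric] Suc.IH)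
  finally show ?case .
qed simp

lemma sum_cis_roots:
  assumes "0 < c" "c < b"
  shows "(\<Sum>j<b. cis (2 * pi * (real j * (real c / real b)))) = 0"
proof -
  define w where "w = cis (2 * pi * (real c / real b))"
  have "w ^ b = cis (2 * pi * real c)"
    using assms by (simp add: w_def Complex.DeMoivre)
  also have "\<dots> = 1"
    by (rule cis_multiple_2pi) auto
  finally have "w ^ b = 1" .
  moreover have "w \<noteq> 1"
  proof
    assume "w = 1"
    then have "cos (2 * pi * (real c / real b)) = 1"
      by (simp add: w_def complex_eq_iff)
    then obtain n :: int where "2 * pi * (real c / real b) = of_int n * 2 * pi"
      using cos_one_2pi_int by blast
    then have "(2 * pi) * (real c / real b) = (2 * pi) * of_int n"
      by (simp only: mult_ac)
    then have "real c / real b = of_int n"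
      by (subst (asm) mult_cancel_left) auto
    moreover have "0 < real c / real b" "real c / real b < 1"
      using assms by auto
    ultimately show False
      by (metis of_int_0_less_iff of_int_less_1_iff zle_add1_eq_le add_0 not_le)
  qed
  moreover have "(\<Sum>j<b. cis (2 * pi * (real j * (real c / real b)))) = (\<Sum>j<b. w ^ j)"
    by (simp add: w_def Complex.DeMoivre mult_ac)
  ultimately show ?thesis
    by (simp add: geometric_sum)
qed

text \<open>The character of a node is a product over its digits, so the sum factors into geometric
  sums \<open>G t\<close>. All of them are trivial if the wavenumber is 0, because lower wavenumbers
  are its residues; otherwise a single vanishing factor suffices.\<close>

lemma lattice_character_sum:
  assumes "b > 1"
  shows "(\<Sum>i<b ^ m. fchar k (z_node b a i)) = (if wavenum b a m k = 0 then of_nat (b ^ m) else 0)"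
proof -
  define G where "G = (\<lambda>t. \<Sum>j<b. cis (2 * pi * (real j * (real (wavenum b a (Suc t) k) / real (b ^ Suc t)))))"
  have "(\<Sum>i<b ^ m. fchar k (z_node b a i)) = (\<Prod>t<m. G t)"
    unfolding G_def using assms
    by (subst sum_prod_digits[symmetric]) (simp, intro sum.cong refl, simp only: lessThan_iff fchar_z_node)
  also have "\<dots> = (if wavenum b a m k = 0 then of_nat (b ^ m) else 0)"
  proof (cases "wavenum b a m k = 0")
    case True
    have "G t = of_nat b" if "t < m" for t
      using that True wavenum_mod[of b "Suc t" m a k] assms by (simp add: G_def)
    then show ?thesis
      using True by simp
  next
    case False
    \<comment> \<open>At the first level with nonzero wavenumber, the previous one being 0 forces
      the value \<open>b ^ s * c\<close> with \<open>0 < c < b\<close>. So \<open>G s\<close> sums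
      the powers of a \<open>b\<close>-th root of unity other than 1.\<close>
    define t where "t = (LEAST t. wavenum b a t k \<noteq> 0)"
    have t: "wavenum b a t k \<noteq> 0" "t \<le> m"
      unfolding t_def using False by (rule LeastI, rule Least_le)
    have "t \<noteq> 0"
      using t(1) by (intro notI) (simp add: wavenum_def)
    then obtain s where s: "t = Suc s"
      by (cases t) auto
    have "wavenum b a s k = 0"
      using not_less_Least[of s "\<lambda>t. wavenum b a t k \<noteq> 0"] s by (simp add: t_def)
    then have "b ^ s dvd wavenum b a (Suc s) k"
      using wavenum_Suc_mod[of b a s k] assms by auto
    then obtain c where c: "wavenum b a (Suc s) k = b ^ s * c"
      by blast
    have "0 < c" "c < b"
      using t(1) wavenum_less[of b a "Suc s" k] assms s by (auto simp: c)
    have "real (b ^ s * c) / real (b ^ Suc s) = real c / real b"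
      using assms by simp
    then have "G s = 0"
      unfolding G_def c using sum_cis_roots[OF \<open>0 < c\<close> \<open>c < b\<close>] by (simp only:)
    then have "(\<Prod>t<m. G t) = 0"
      using t(2) s by (intro prod_zero) auto
    then show ?thesis
      using False by simp
  qed
  finally show ?thesis .
qed

section \<open>Aliasing\<close>

text \<open>The recursive choice of \<open>kt\<close> acts on the new digit as the transposition of
  0 and \<alpha>: \<open>\<kappa>\<close> itself already carries digit \<alpha>, so
  \<open>\<kappa> + \<alpha> * b ^ m\<close> receives digit 0 and all others keep theirs.\<close>

lemma wavenumber_map_step:
  assumes "b > 0" "wavenumber_map b a kt" "\<kappa> < b ^ m"
  obtains \<sigma> where "inj_on \<sigma> {..<b}"
    "\<And>\<beta>. \<beta> < b \<Longrightarrow> wavenum b a (Suc m) (kt (\<kappa> + \<beta> * b ^ m)) = wavenum b a m (kt \<kappa>) + \<sigma> \<beta> * b ^ m"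
proof -
  define v where "v = wavenum b a m (kt \<kappa>)"
  define \<alpha> where "\<alpha> = wavenum b a (Suc m) (kt \<kappa>) div b ^ m"
  have "wavenum b a (Suc m) (kt \<kappa>) mod b ^ m = v"
    unfolding v_def by (rule wavenum_Suc_mod[OF assms(1)])
  then have \<alpha>: "wavenum b a (Suc m) (kt \<kappa>) = v + \<alpha> * b ^ m"
    unfolding \<alpha>_def by (metis mod_div_mult_eq)
  have "\<alpha> < b"
    unfolding \<alpha>_def using wavenum_less[OF assms(1), of a "Suc m" "kt \<kappa>"] by (simp add: less_mult_imp_div_less)
  then have step: "(\<alpha> \<noteq> 0 \<longrightarrow> wavenum b a (Suc m) (kt (\<kappa> + \<alpha> * b ^ m)) = v) \<and>
      (\<forall>\<beta>\<in>{1..b - 1} - {\<alpha>}. wavenum b a (Suc m) (kt (\<kappa> + \<beta> * b ^ m)) = v + \<beta> * b ^ m)"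
    using assms(2,3) \<alpha> unfolding wavenumber_map_def v_def by blast
  define \<sigma> where "\<sigma> = (\<lambda>\<beta>. if \<beta> = 0 then \<alpha> else if \<beta> = \<alpha> then 0 else \<beta>)"
  show ?thesis
  proof (rule that)
    show "inj_on \<sigma> {..<b}"
      by (auto simp: inj_on_def \<sigma>_def split: if_splits)
    fix \<beta> assume "\<beta> < b"
    then show "wavenum b a (Suc m) (kt (\<kappa> + \<beta> * b ^ m)) = wavenum b a m (kt \<kappa>) + \<sigma> \<beta> * b ^ m"
      using step \<alpha> by (auto simp: \<sigma>_def v_def[symmetric])
  qed
qed

text \<open>Each step of the construction changes only the newest digit of the wavenumber, so digits
  of \<open>n\<close> from position \<open>m\<close> on can be stripped one by one, from the
  top.\<close>

lemma wavenum_kt_mod: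
  assumes "b > 1" "wavenumber_map b a kt"
  shows "wavenum b a m (kt n) = wavenum b a m (kt (n mod b ^ m))"
proof -
  have b: "b > 0" using assms(1) by simp
  have "\<forall>n<b ^ N. wavenum b a m (kt n) = wavenum b a m (kt (n mod b ^ m))" if "m \<le> N" for N
    using that
  proof (induction N rule: dec_induct)
    case (step N)
    show ?case
    proof (intro allI impI)
      fix n assume "n < b ^ Suc N"
      define \<kappa> where "\<kappa> = n mod b ^ N"
      define \<beta> where "\<beta> = n div b ^ N"
      have \<kappa>: "\<kappa> < b ^ N" and \<beta>: "\<beta> < b"
        using \<open>n < b ^ Suc N\<close> b by (auto simp: \<kappa>_def \<beta>_def less_mult_imp_div_less)
      have n: "n = \<kappa> + \<beta> * b ^ N"
        unfolding \<kappa>_def \<beta>_def by (rule mod_div_mult_eq[symmetric])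
      obtain \<sigma> where "wavenum b a (Suc N) (kt n) = wavenum b a N (kt \<kappa>) + \<sigma> * b ^ N"
        using wavenumber_map_step[OF b assms(2) \<kappa>] \<beta> n by metis
      then have "wavenum b a (Suc N) (kt n) mod b ^ N = wavenum b a N (kt \<kappa>) mod b ^ N"
        by simp
      then have "wavenum b a N (kt n) = wavenum b a N (kt \<kappa>)"
        using wavenum_less[OF b, of a N "kt \<kappa>"] by (simp add: wavenum_Suc_mod[OF b])
      then have "wavenum b a m (kt n) = wavenum b a m (kt \<kappa>)"
        using wavenum_mod[OF b step.hyps(1)] by metis
      moreover have "\<kappa> mod b ^ m = n mod b ^ m"
        unfolding \<kappa>_def using step.hyps by (simp add: mod_mod_cancel le_imp_power_dvd)
      ultimately show "wavenum b a m (kt n) = wavenum b a m (kt (n mod b ^ m))"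
        using step.IH \<kappa> by metis
    qed
  qed simp
  \<comment> \<open>The level \<open>n + m\<close> is at least \<open>m\<close> and satisfies
    \<open>n < b ^ (n + m)\<close>.\<close>
  from this[of "n + m"] show ?thesis
    using power_gt_expt[of b "n + m"] assms(1) by auto
qed

text \<open>The induction hypothesis identifies the residues modulo \<open>b ^ m\<close>. Both
  indices then lie over the same \<rho>, and injectivity of its digit map \<sigma> identifies the
  top digits.\<close>

lemma wavenum_kt_inj:
  assumes "b > 1" "wavenumber_map b a kt"
  shows "\<kappa> < b ^ m \<Longrightarrow> \<mu> < b ^ m \<Longrightarrow> wavenum b a m (kt \<kappa>) = wavenum b a m (kt \<mu>) \<Longrightarrow> \<kappa> = \<mu>"
proof (induction m arbitrary: \<kappa> \<mu>)
  case (Suc m)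
  have b: "b > 0" using assms(1) by simp
  define \<rho> where "\<rho> = \<kappa> mod b ^ m"
  have "wavenum b a m (kt \<kappa>) = wavenum b a m (kt \<mu>)"
    using Suc.prems(3) wavenum_Suc_mod[OF b] by metis
  then have "wavenum b a m (kt (\<kappa> mod b ^ m)) = wavenum b a m (kt (\<mu> mod b ^ m))"
    by (metis wavenum_kt_mod[OF assms])
  with Suc.IH[of "\<kappa> mod b ^ m" "\<mu> mod b ^ m"] b have \<rho>': "\<rho> = \<mu> mod b ^ m"
    unfolding \<rho>_def by (meson mod_less_divisor zero_less_power)
  have \<rho>: "\<rho> < b ^ m"
    using b by (simp add: \<rho>_def)
  obtain \<sigma> where \<sigma>: "inj_on \<sigma> {..<b}"
    "\<And>\<beta>. \<beta> < b \<Longrightarrow> wavenum b a (Suc m) (kt (\<rho> + \<beta> * b ^ m)) = wavenum b a m (kt \<rho>) + \<sigma> \<beta> * b ^ m"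
    using wavenumber_map_step[OF b assms(2) \<rho>] by metis
  have \<kappa>: "\<kappa> = \<rho> + (\<kappa> div b ^ m) * b ^ m"
    unfolding \<rho>_def by (rule mod_div_mult_eq[symmetric])
  have \<mu>: "\<mu> = \<rho> + (\<mu> div b ^ m) * b ^ m"
    unfolding \<rho>' by (rule mod_div_mult_eq[symmetric])
  have less: "\<kappa> div b ^ m < b" "\<mu> div b ^ m < b"
    using Suc.prems by (auto simp: less_mult_imp_div_less)
  have "\<sigma> (\<kappa> div b ^ m) * b ^ m = \<sigma> (\<mu> div b ^ m) * b ^ m"
    using Suc.prems(3) \<sigma>(2)[OF less(1)] \<sigma>(2)[OF less(2)]
    unfolding \<kappa>[symmetric] \<mu>[symmetric] by simp
  then have "\<sigma> (\<kappa> div b ^ m) = \<sigma> (\<mu> div b ^ m)"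
    using b by simp
  then have "\<kappa> div b ^ m = \<mu> div b ^ m"
    using \<sigma>(1) less by (auto dest: inj_onD)
  then show ?case
    using \<kappa> \<mu> by metis
qed simp

lemma wavenum_kt_eq_iff:
  assumes "b > 1" "wavenumber_map b a kt" "\<kappa> < b ^ m"
  shows "wavenum b a m (kt n) = wavenum b a m (kt \<kappa>) \<longleftrightarrow> n mod b ^ m = \<kappa>"
proof -
  have "n mod b ^ m < b ^ m"
    using assms(1) by simp
  then show ?thesis
    using wavenum_kt_mod[OF assms(1,2), of m n] wavenum_kt_inj[OF assms(1,2) _ assms(3)] by metis
qed

lemma has_sum_finite_sums:
  fixes g :: "'a \<Rightarrow> 'b \<Rightarrow> 'c::topological_comm_monoid_add"
  assumes "\<And>i. i \<in> I \<Longrightarrow> (g i has_sum s i) A" 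
  shows "((\<lambda>n. \<Sum>i\<in>I. g i n) has_sum (\<Sum>i\<in>I. s i)) A"
  using assms by (induction I rule: infinite_finite_induct) (auto intro: has_sum_add)

text \<open>Inserting the series at all nodes and exchanging it with the finite sum leaves a
  character sum for each \<open>n\<close>, which vanishes unless
  \<open>n mod b ^ m = \<kappa>\<close>. The shift is common to all nodes and survives as the phase
  at \<Delta>.\<close>

lemma aliasing_has_sum:
  fixes f :: "real^'d \<Rightarrow> complex"
  assumes b: "b > 1" and kt: "wavenumber_map b a kt" and \<kappa>: "\<kappa> < b ^ m"
    and f: "\<And>x. ((\<lambda>n. c n * fchar (kt n) x) has_sum f x) UNIV"
  shows "((\<lambda>\<mu>. c (\<kappa> + \<mu> * b ^ m) * fchar (kt (\<kappa> + \<mu> * b ^ m) - kt \<kappa>) \<Delta>)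
           has_sum disc_coeff b a \<Delta> m f (kt \<kappa>)) UNIV"
proof -
  define G where "G = (\<lambda>n. c n * fchar (kt n - kt \<kappa>) \<Delta>)"
  define x where "x = (\<lambda>i. z_node b a i \<oplus> \<Delta>)"
  have x: "fchar k (x i) = fchar k (z_node b a i) * fchar k \<Delta>" for k i
    by (simp add: x_def oplus_def fchar_frac_vec fchar_add_right)
  have "((\<lambda>n. (\<Sum>i<b ^ m. fchar (- kt \<kappa>) (x i) * (c n * fchar (kt n) (x i))) * (1 / of_nat (b ^ m)))
      has_sum (\<Sum>i<b ^ m. fchar (- kt \<kappa>) (x i) * f (x i)) * (1 / of_nat (b ^ m))) UNIV"
    by (intro has_sum_cmult_left has_sum_finite_sums has_sum_cmult_right f)
  also have "(\<Sum>i<b ^ m. fchar (- kt \<kappa>) (x i) * f (x i)) * (1 / of_nat (b ^ m)) = disc_coeff b a \<Delta> m f (kt \<kappa>)"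
    by (simp add: disc_coeff_def x_def exp_lpair[simplified])
  also have "(\<lambda>n. (\<Sum>i<b ^ m. fchar (- kt \<kappa>) (x i) * (c n * fchar (kt n) (x i))) * (1 / of_nat (b ^ m))) =
      (\<lambda>n. if n mod b ^ m = \<kappa> then G n else 0)"
  proof
    fix n
    have "(\<Sum>i<b ^ m. fchar (- kt \<kappa>) (x i) * (c n * fchar (kt n) (x i))) =
        (\<Sum>i<b ^ m. G n * fchar (kt n - kt \<kappa>) (z_node b a i))"
    proof (rule sum.cong[OF refl])
      fix i
      have "fchar (- kt \<kappa>) (x i) * (c n * fchar (kt n) (x i)) = c n * fchar (kt n - kt \<kappa>) (x i)"
        unfolding diff_conv_add_uminus fchar_add by (simp only: mult_ac)
      then show "fchar (- kt \<kappa>) (x i) * (c n * fchar (kt n) (x i)) = G n * fchar (kt n - kt \<kappa>) (z_node b a i)"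
        by (simp add: x G_def mult_ac)
    qed
    also have "\<dots> = G n * (if wavenum b a m (kt n - kt \<kappa>) = 0 then of_nat (b ^ m) else 0)"
      by (simp only: sum_distrib_left[symmetric] lattice_character_sum[OF b])
    also have "wavenum b a m (kt n - kt \<kappa>) = 0 \<longleftrightarrow> n mod b ^ m = \<kappa>"
      using wavenum_diff_eq_0_iff[of b a m] wavenum_kt_eq_iff[OF b kt \<kappa>] b by simp
    finally show "(\<Sum>i<b ^ m. fchar (- kt \<kappa>) (x i) * (c n * fchar (kt n) (x i))) * (1 / of_nat (b ^ m)) =
        (if n mod b ^ m = \<kappa> then G n else 0)"
      using b by simp
  qed
  also have "((\<lambda>n. if n mod b ^ m = \<kappa> then G n else 0) has_sum S) UNIV \<longleftrightarrow> (G has_sum S) {n. n mod b ^ m = \<kappa>}" for S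
    by (rule has_sum_cong_neutral) auto
  also have "{n. n mod b ^ m = \<kappa>} = (\<lambda>\<mu>. \<kappa> + \<mu> * b ^ m) ` UNIV"
  proof (intro equalityI subsetI)
    fix n assume "n \<in> {n. n mod b ^ m = \<kappa>}"
    then have n: "n mod b ^ m = \<kappa>"
      by (rule CollectD)
    have "n = \<kappa> + (n div b ^ m) * b ^ m"
      unfolding n[symmetric] by (simp only: mod_div_mult_eq)
    then show "n \<in> range (\<lambda>\<mu>. \<kappa> + \<mu> * b ^ m)" by blast
  qed (use \<kappa> in auto)
  finally show ?thesis
    using b by (subst (asm) has_sum_reindex) (auto simp: inj_on_def o_def G_def)
qed

text \<open>Removing the term \<mu> = 0 of the aliasing series subtracts exactly
  \<open>c \<kappa>\<close>; the phases of the others have modulus 1.\<close>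

lemma disc_coeff_error:
  fixes f :: "real^'d \<Rightarrow> complex"
  assumes b: "b > 1" and kt: "wavenumber_map b a kt" and \<kappa>: "\<kappa> < b ^ m"
    and f: "\<And>x. ((\<lambda>n. c n * fchar (kt n) x) has_sum f x) UNIV"
    and c: "(\<lambda>n. norm (c n)) summable_on UNIV"
  shows "norm (disc_coeff b a \<Delta> m f (kt \<kappa>) - c \<kappa>) \<le> (\<Sum>\<^sub>\<infinity>\<mu>\<in>{1..}. norm (c (\<kappa> + \<mu> * b ^ m)))"
proof -
  define h where "h = (\<lambda>\<mu>. c (\<kappa> + \<mu> * b ^ m) * fchar (kt (\<kappa> + \<mu> * b ^ m) - kt \<kappa>) \<Delta>)"
  have "inj (\<lambda>\<mu>. \<kappa> + \<mu> * b ^ m)"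
    using b by (auto simp: inj_on_def)
  then have "(\<lambda>\<mu>. norm (c (\<kappa> + \<mu> * b ^ m))) summable_on UNIV"
    using summable_on_subset_banach[OF c subset_UNIV, of "range (\<lambda>\<mu>. \<kappa> + \<mu> * b ^ m)"]
    by (simp add: summable_on_reindex o_def)
  then have "(\<lambda>\<mu>. norm (c (\<kappa> + \<mu> * b ^ m))) summable_on {1..}"
    by (rule summable_on_subset_banach) simp
  then have s: "((\<lambda>\<mu>. norm (c (\<kappa> + \<mu> * b ^ m))) has_sum (\<Sum>\<^sub>\<infinity>\<mu>\<in>{1..}. norm (c (\<kappa> + \<mu> * b ^ m)))) {1..}"
    by (rule has_sum_infsum)
  have "(h has_sum disc_coeff b a \<Delta> m f (kt \<kappa>)) UNIV"
    unfolding h_def by (rule aliasing_has_sum[OF b kt \<kappa> f])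
  from has_sum_Diff[OF this, of "{0}" "h 0"]
  have "(h has_sum (disc_coeff b a \<Delta> m f (kt \<kappa>) - h 0)) (UNIV - {0})"
    by (simp add: has_sum_finiteI)
  also have "UNIV - {0} = {1::nat..}"
    by auto
  finally have "(h has_sum (disc_coeff b a \<Delta> m f (kt \<kappa>) - c \<kappa>)) {1..}"
    by (simp add: h_def)
  from norm_infsum_le[OF this s] show ?thesis
    by (simp add: h_def norm_mult)
qed

section \<open>Error bounds for admissible integrands\<close>

lemma integrand_fourier_series:
  fixes f :: "real^'d \<Rightarrow> complex"
  assumes f: "f \<in> AC_integrands" and kt: "wavenumber_map b a kt"
  shows "(\<lambda>n. norm (fourier_coeff f (kt n))) summable_on UNIV"
    and "((\<lambda>n. fourier_coeff f (kt n) * fchar (kt n) x) has_sum f x) UNIV"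
proof -
  have bij: "bij kt"
    using kt by (simp add: wavenumber_map_def)
  have "(\<lambda>k. norm (fourier_coeff f k)) summable_on UNIV"
    using f by (simp add: AC_integrands_def)
  then show s: "(\<lambda>n. norm (fourier_coeff f (kt n))) summable_on UNIV"
    using summable_on_reindex_bij_betw[OF bij, of "\<lambda>k. norm (fourier_coeff f k)"] by simp
  show "((\<lambda>n. fourier_coeff f (kt n) * fchar (kt n) x) has_sum f x) UNIV"
    by (rule fourier_inversion[OF _ _ bij summable_on_imp_summable[OF s]])
       (use f in \<open>auto simp: AC_integrands_def abs_continuous_cube_def\<close>)
qed

text \<open>Integral and cubature rule are the exact and the discrete coefficient at frequency 0,
  which \<open>kt\<close> places at index 0.\<close>

lemma cubature_error:
  fixes f :: "real^'d \<Rightarrow> complex"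
  assumes b: "b > 1" and kt: "wavenumber_map b a kt" and f: "f \<in> AC_integrands"
  shows "norm (cube_integral f - cubature b a \<Delta> m f) \<le> S_hat b kt 0 m f"
proof -
  have kt0: "kt 0 = 0"
    using kt by (simp add: wavenumber_map_def)
  have "norm (disc_coeff b a \<Delta> m f (kt 0) - fourier_coeff f (kt 0)) \<le>
      (\<Sum>\<^sub>\<infinity>\<mu>\<in>{1..}. norm (fourier_coeff f (kt (0 + \<mu> * b ^ m))))"
    using b by (intro disc_coeff_error[OF b kt _ integrand_fourier_series(2)[OF f kt]] integrand_fourier_series(1)[OF f kt]) auto
  moreover have "disc_coeff b a \<Delta> m f (kt 0) = cubature b a \<Delta> m f"
    by (simp add: kt0 disc_coeff_def cubature_def exp_lpair[simplified])
  moreover have "fourier_coeff f (kt 0) = cube_integral f"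
    by (simp add: kt0 fourier_coeff_eq)
  \<comment> \<open>For \<open>l = 0\<close> the block consists of index 0 alone, because
    \<open>1 div b = 0\<close>.\<close>
  moreover have "{b ^ 0 div b..<b ^ 0} = {0::nat}"
    using b by auto
  ultimately show ?thesis
    by (simp add: S_hat_def norm_minus_commute)
qed

lemma S_tilde_diff:
  fixes f :: "real^'d \<Rightarrow> complex"
  assumes b: "b > 1" and kt: "wavenumber_map b a kt" and f: "f \<in> AC_integrands" and "l \<le> m"
  shows "\<bar>S_tilde b a \<Delta> kt l m f - S_sum b kt l f\<bar> \<le> S_hat b kt l m f"
proof -
  have "\<bar>S_tilde b a \<Delta> kt l m f - S_sum b kt l f\<bar> =
      \<bar>\<Sum>\<kappa>\<in>{b ^ l div b..<b ^ l}. norm (disc_coeff b a \<Delta> m f (kt \<kappa>)) - norm (fourier_coeff f (kt \<kappa>))\<bar>"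
    by (simp add: S_tilde_def S_sum_def sum_subtractf)
  also have "\<dots> \<le> (\<Sum>\<kappa>\<in>{b ^ l div b..<b ^ l}. \<bar>norm (disc_coeff b a \<Delta> m f (kt \<kappa>)) - norm (fourier_coeff f (kt \<kappa>))\<bar>)"
    by (rule sum_abs)
  also have "\<dots> \<le> S_hat b kt l m f"
    unfolding S_hat_def
  proof (rule sum_mono)
    fix \<kappa> assume "\<kappa> \<in> {b ^ l div b..<b ^ l}"
    moreover have "b ^ l \<le> b ^ m"
      using b \<open>l \<le> m\<close> by (intro power_increasing) auto
    ultimately have "\<kappa> < b ^ m"
      by simp
    have "\<bar>norm (disc_coeff b a \<Delta> m f (kt \<kappa>)) - norm (fourier_coeff f (kt \<kappa>))\<bar> \<le>
        norm (disc_coeff b a \<Delta> m f (kt \<kappa>) - fourier_coeff f (kt \<kappa>))"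
      by (rule norm_triangle_ineq3)
    also have "\<dots> \<le> (\<Sum>\<^sub>\<infinity>\<mu>\<in>{1..}. norm (fourier_coeff f (kt (\<kappa> + \<mu> * b ^ m))))"
      by (intro disc_coeff_error[OF b kt \<open>\<kappa> < b ^ m\<close> integrand_fourier_series(2)[OF f kt]] integrand_fourier_series(1)[OF f kt])
    finally show "\<bar>norm (disc_coeff b a \<Delta> m f (kt \<kappa>)) - norm (fourier_coeff f (kt \<kappa>))\<bar> \<le> \<dots>" .
  qed
  finally show ?thesis .
qed

text \<open>Each block is the difference of two partial sums, taken at consecutive powers of
  \<open>b\<close>, of one convergent series.\<close>

lemma S_sum_tendsto_0:
  fixes f :: "real^'d \<Rightarrow> complex"
  assumes b: "b > 1" and kt: "wavenumber_map b a kt" and f: "f \<in> AC_integrands"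
  shows "(\<lambda>m. S_sum b kt m f) \<longlonglongrightarrow> 0"
proof -
  define g where "g = (\<lambda>n. norm (fourier_coeff f (kt n)))"
  have "summable g"
    unfolding g_def by (rule summable_on_imp_summable[OF integrand_fourier_series(1)[OF f kt]])
  then have T: "(\<lambda>n. \<Sum>i<n. g i) \<longlonglongrightarrow> suminf g"
    by (rule summable_LIMSEQ)
  have pow: "filterlim (\<lambda>m. b ^ m) at_top sequentially"
    using b by (intro filterlim_subseq strict_monoI power_strict_increasing) auto
  have "(\<lambda>m. (\<Sum>i<b ^ Suc m. g i) - (\<Sum>i<b ^ m. g i)) \<longlonglongrightarrow> suminf g - suminf g"
    by (intro tendsto_diff filterlim_compose[OF T] filterlim_compose[OF pow filterlim_Suc] pow)
  moreover have "(\<Sum>i<b ^ Suc m. g i) - (\<Sum>i<b ^ m. g i) = S_sum b kt (Suc m) f" for m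
  proof -
    have "b ^ m \<le> b ^ Suc m" using b by simp
    then have "(\<Sum>i<b ^ Suc m. g i) = (\<Sum>i<b ^ m. g i) + (\<Sum>i\<in>{b ^ m..<b ^ Suc m}. g i)"
      by (metis atLeast0LessThan le0 sum.atLeastLessThan_concat)
    then show ?thesis
      using b by (simp add: S_sum_def g_def)
  qed
  ultimately have "(\<lambda>m. S_sum b kt (Suc m) f) \<longlonglongrightarrow> 0"
    by simp
  then show ?thesis
    by (rule LIMSEQ_imp_Suc)
qed

section \<open>Cost and correctness of the algorithm\<close>

lemma ret_simps [simp]: "result (ret x) = x" "evals (ret x) = 0" "ops (ret x) = 0"
  by (simp_all add: ret_def)

lemma bindC_simps [simp]:
  "result (p \<triangleright> q) = result (q (result p))"
  "evals (p \<triangleright> q) = evals p + evals (q (result p))"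
  "ops (p \<triangleright> q) = ops p + ops (q (result p))"
  by (simp_all add: bindC_def Let_def)

lemma primitive_simps [simp]:
  "result (feval f x) = f x" "evals (feval f x) = 1" "ops (feval f x) = 0"
  "result (addC u v) = u + v" "evals (addC u v) = 0" "ops (addC u v) = 1"
  "result (mulC s t) = s * t" "evals (mulC s t) = 0" "ops (mulC s t) = 1"
  "result (absC c) = norm c" "evals (absC c) = 0" "ops (absC c) = 1"
  "result (leqC d e) = (d \<le> e)" "evals (leqC d e) = 0" "ops (leqC d e) = 1"
  by (simp_all add: feval_def addC_def mulC_def absC_def leqC_def)

lemma mapC_simps [simp]:
  "result (mapC g xs) = map (\<lambda>x. result (g x)) xs"
  "evals (mapC g xs) = (\<Sum>x\<leftarrow>xs. evals (g x))"
  "ops (mapC g xs) = (\<Sum>x\<leftarrow>xs. ops (g x))"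
  by (induction xs) simp_all

lemma sumC_simps [simp]:
  "result (sumC xs) = sum_list xs" "evals (sumC xs) = 0" "ops (sumC xs) = length xs"
  by (induction xs) simp_all

lemma sum_list_upt: "(\<Sum>i\<leftarrow>[m..<n]. g i) = (\<Sum>i\<in>{m..<n}. g i)"
  by (simp add: interv_sum_list_conv_sum_set_nat)

section \<open>Correctness and cost of the fast Fourier transform\<close>

lemma fft_entry_result:
  "result (fft_entry b n ys p) = (\<Sum>j<b. cis (- 2 * pi * (real j * (real (p mod b ^ Suc n) / real (b ^ Suc n)))) *
      ys ! (p mod b ^ n + j * b ^ n + p div b ^ Suc n * b ^ Suc n))"
proof -
  have "exp (- 2 * of_real pi * \<i> * of_nat j * of_nat v / of_nat w) = cis (- 2 * pi * (real j * (real v / real w)))" for j v w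
    by (simp add: cis_conv_exp mult_ac)
  moreover have "p mod b ^ Suc n mod b ^ n = p mod b ^ n"
    by (rule mod_mod_cancel) simp
  ultimately show ?thesis
    by (simp only: fft_entry_def Let_def bindC_simps mapC_simps sumC_simps primitive_simps sum_list_upt atLeast0LessThan)
qed

text \<open>There are \<open>b\<close> multiplications and \<open>b\<close> additions;
  \<open>sumC\<close> also pays for the addition to the initial 0.\<close>

lemma fft_entry_cost [simp]: "evals (fft_entry b n ys p) = 0" "ops (fft_entry b n ys p) = 2 * b"
  by (simp_all add: fft_entry_def Let_def sum_list_triv)

lemma fft_stages_cost:
  "evals (fft_stages b n ys) = 0 \<and> length (result (fft_stages b n ys)) = length ys \<and>
   ops (fft_stages b n ys) = n * length ys * (2 * b)"
  by (induction n) (simp_all add: fft_stage_def sum_list_triv algebra_simps)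

text \<open>The loop invariant of the transform. In a position \<open>p\<close> after
  \<open>n\<close> stages, the low \<open>n\<close> digits are a frequency residue and the higher
  digits are the sample digits not yet summed over.\<close>

lemma fft_stages_nth:
  assumes b: "b > 1" and ys: "length ys = b ^ m" and "n \<le> m" "p < b ^ m"
  shows "result (fft_stages b n ys) ! p =
    (\<Sum>i<b ^ n. cis (- 2 * pi * (\<Sum>l<n. real (i div b ^ l mod b) * (real (p mod b ^ Suc l) / real (b ^ Suc l)))) *
      ys ! (i + p div b ^ n * b ^ n))"
  using assms(3,4)
proof (induction n arbitrary: p)
  case (Suc n)
  define \<phi> where "\<phi> = (\<lambda>n i p. \<Sum>l<n. real (i div b ^ l mod b) * (real (p mod b ^ Suc l) / real (b ^ Suc l)))"
  define hi where "hi = p div b ^ Suc n"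
  define ys' where "ys' = result (fft_stages b n ys)"
  have len: "length ys' = b ^ m"
    using fft_stages_cost ys by (simp add: ys'_def)
  have "result (fft_stages b (Suc n) ys) ! p = result (fft_entry b n ys' p)"
    using Suc.prems len by (simp add: fft_stage_def ys'_def[symmetric])
  also have "\<dots> = (\<Sum>j<b. cis (- 2 * pi * (real j * (real (p mod b ^ Suc n) / real (b ^ Suc n)))) *
      ys' ! (p mod b ^ n + j * b ^ n + hi * b ^ Suc n))"
    unfolding fft_entry_result hi_def ..
  also have "\<dots> = (\<Sum>j<b. \<Sum>i<b ^ n. cis (- 2 * pi * \<phi> (Suc n) (i + j * b ^ n) p) *
      ys ! (i + j * b ^ n + hi * b ^ Suc n))"
  proof (rule sum.cong[OF refl])
    fix j assume "j \<in> {..<b}"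
    then have j: "j < b" by simp
    \<comment> \<open>The position read by stage \<open>n\<close> for the digit \<open>j\<close>:
      the frequency part of \<open>p\<close> is cut to \<open>n\<close> digits, and \<open>j\<close>
      takes the place of digit \<open>n\<close>.\<close>
    define q where "q = p mod b ^ n + (j + hi * b) * b ^ n"
    have q: "p mod b ^ n + j * b ^ n + hi * b ^ Suc n = q"
      by (simp add: q_def algebra_simps)
    have "p mod b ^ n < b ^ n"
      using b by simp
    then have q_div: "q div b ^ n = j + hi * b" and q_mod: "q mod b ^ n = p mod b ^ n"
      unfolding q_def using b by (simp_all only: div_mult_self1 mod_mult_self1) simp_all
    have "q < b ^ m"
    proof -
      obtain s where s: "m = Suc n + s"
        using Suc.prems(1) le_Suc_ex by blast
      have "hi < b ^ s"
        unfolding hi_def using Suc.prems(2) by (intro less_mult_imp_div_less) (simp add: s power_add mult_ac)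
      have "q < (j + hi * b + 1) * b ^ n"
        using \<open>p mod b ^ n < b ^ n\<close> by (simp add: q_def)
      also have "j + hi * b + 1 \<le> (hi + 1) * b"
        using j by (simp add: algebra_simps)
      also have "\<dots> \<le> b ^ s * b"
        using \<open>hi < b ^ s\<close> by (intro mult_right_mono) auto
      finally show ?thesis
        by (simp add: s power_add mult_ac)
    qed
    \<comment> \<open>The inner phases use residues modulo at most \<open>b ^ n\<close>, on which
      \<open>p\<close> and \<open>q\<close> agree.\<close>
    have \<phi>_q: "\<phi> n i q = \<phi> n i p" for i
      unfolding \<phi>_def
    proof (rule sum.cong[OF refl])
      fix l assume "l \<in> {..<n}"
      then have "b ^ Suc l dvd b ^ n"
        by (intro le_imp_power_dvd) auto
      then have "q mod b ^ Suc l = p mod b ^ Suc l"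
        using q_mod by (metis mod_mod_cancel)
      then show "real (i div b ^ l mod b) * (real (q mod b ^ Suc l) / real (b ^ Suc l)) =
          real (i div b ^ l mod b) * (real (p mod b ^ Suc l) / real (b ^ Suc l))"
        by (simp only:)
    qed
    have "ys' ! q = (\<Sum>i<b ^ n. cis (- 2 * pi * \<phi> n i p) * ys ! (i + j * b ^ n + hi * b ^ Suc n))"
    proof -
      have IH: "ys' ! q = (\<Sum>i<b ^ n. cis (- 2 * pi * \<phi> n i q) * ys ! (i + q div b ^ n * b ^ n))"
        unfolding ys'_def \<phi>_def using Suc.prems(1) \<open>q < b ^ m\<close> by (intro Suc.IH) auto
      have "i + (j + hi * b) * b ^ n = i + j * b ^ n + hi * b ^ Suc n" for i
        by (simp add: algebra_simps)
      then show ?thesis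
        unfolding IH \<phi>_q q_div by (simp only:)
    qed
    moreover have "cis (- 2 * pi * (real j * (real (p mod b ^ Suc n) / real (b ^ Suc n)))) * cis (- 2 * pi * \<phi> n i p) =
        cis (- 2 * pi * \<phi> (Suc n) (i + j * b ^ n) p)" if "i < b ^ n" for i
    proof -
      have "(i + j * b ^ n) div b ^ n mod b = j"
        using that j by simp
      moreover have "\<phi> n (i + j * b ^ n) p = \<phi> n i p"
        unfolding \<phi>_def using b by (intro sum.cong refl) (simp add: digit_add)
      ultimately have "\<phi> (Suc n) (i + j * b ^ n) p = \<phi> n i p + real j * (real (p mod b ^ Suc n) / real (b ^ Suc n))"
        by (simp add: \<phi>_def)
      then show ?thesis
        by (simp only: cis_mult) (simp add: algebra_simps)
    qed
    ultimately show "cis (- 2 * pi * (real j * (real (p mod b ^ Suc n) / real (b ^ Suc n)))) *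
        ys' ! (p mod b ^ n + j * b ^ n + hi * b ^ Suc n) =
        (\<Sum>i<b ^ n. cis (- 2 * pi * \<phi> (Suc n) (i + j * b ^ n) p) * ys ! (i + j * b ^ n + hi * b ^ Suc n))"
      unfolding q by (simp only: sum_distrib_left mult.assoc[symmetric]) (auto intro!: sum.cong)
  qed
  also have "\<dots> = (\<Sum>i<b ^ Suc n. cis (- 2 * pi * \<phi> (Suc n) i p) * ys ! (i + hi * b ^ Suc n))"
    using b by (subst sum_digits_split) auto
  finally show ?case
    by (simp only: \<phi>_def hi_def)
qed simp

text \<open>Closed form of the array that the loop holds at level \<open>m\<close>.\<close>

definition samples :: "nat \<Rightarrow> (nat \<Rightarrow> nat^'d) \<Rightarrow> real^'d \<Rightarrow> (real^'d \<Rightarrow> complex) \<Rightarrow> nat \<Rightarrow> complex list" where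
  "samples b a \<Delta> f m = map (\<lambda>i. f (z_node b a i \<oplus> \<Delta>)) [0..<b ^ m]"

lemma length_samples [simp]: "length (samples b a \<Delta> f m) = b ^ m"
  by (simp add: samples_def)

text \<open>The transform works with the characters at the unshifted nodes, so it misses the factor
  \<open>fchar (- k) \<Delta>\<close>. That factor has modulus 1; hence only the norms are
  compared.\<close>

lemma norm_fft_samples:
  fixes f :: "real^'d \<Rightarrow> complex"
  assumes b: "b > 1"
  shows "norm (result (fft b m (samples b a \<Delta> f m)) ! wavenum b a m k) = norm (disc_coeff b a \<Delta> m f k)"
proof -
  define \<nu> where "\<nu> = wavenum b a m k"
  define ys where "ys = samples b a \<Delta> f m"
  have \<nu>: "\<nu> < b ^ m"
    unfolding \<nu>_def by (rule wavenum_less) (use b in simp)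
  have minus: "fchar (- k) x = cnj (fchar k x)" for x
    by (simp add: fchar_def cis_cnj sum_negf)
  have prod_cis: "(\<Prod>l\<in>A. cis (2 * pi * g l)) = cis (2 * pi * sum g A)" for g and A :: "nat set"
    by (induction A rule: infinite_finite_induct) (auto simp: cis_mult ring_distribs)
  have char_node: "fchar (- k) (z_node b a i) =
      cis (- 2 * pi * (\<Sum>l<m. real (i div b ^ l mod b) * (real (\<nu> mod b ^ Suc l) / real (b ^ Suc l))))" if "i < b ^ m" for i
  proof -
    have "\<nu> mod b ^ Suc l = wavenum b a (Suc l) k" if "l < m" for l
      unfolding \<nu>_def using b that by (intro wavenum_mod) auto
    then have "(\<Sum>l<m. real (i div b ^ l mod b) * (real (\<nu> mod b ^ Suc l) / real (b ^ Suc l))) =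
        (\<Sum>l<m. real (i div b ^ l mod b) * (real (wavenum b a (Suc l) k) / real (b ^ Suc l)))"
      by (intro sum.cong refl) (simp only: lessThan_iff)
    then show ?thesis
      unfolding minus fchar_z_node[OF b that, where k = k] prod_cis cis_cnj by simp
  qed
  have "result (fft b m ys) ! \<nu> = (1 / of_nat (b ^ m)) * (result (fft_stages b m ys) ! \<nu>)"
    using \<nu> fft_stages_cost[of b m ys] by (simp add: fft_def ys_def)
  also have "result (fft_stages b m ys) ! \<nu> = (\<Sum>i<b ^ m. fchar (- k) (z_node b a i) * ys ! i)"
    using \<nu> b char_node by (subst fft_stages_nth[where m = m]) (auto simp: ys_def intro!: sum.cong)
  also have "\<dots> = (\<Sum>i<b ^ m. fchar (- k) (z_node b a i) * f (z_node b a i \<oplus> \<Delta>))"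
    by (rule sum.cong) (auto simp: ys_def samples_def)
  finally have 1: "result (fft b m ys) ! \<nu> = (\<Sum>i<b ^ m. fchar (- k) (z_node b a i) * f (z_node b a i \<oplus> \<Delta>)) / of_nat (b ^ m)"
    by simp
  have "disc_coeff b a \<Delta> m f k = (\<Sum>i<b ^ m. fchar (- k) \<Delta> * (fchar (- k) (z_node b a i) * f (z_node b a i \<oplus> \<Delta>))) / of_nat (b ^ m)"
    unfolding disc_coeff_def exp_lpair by (simp add: oplus_def fchar_frac_vec fchar_add_right mult_ac)
  also have "\<dots> = fchar (- k) \<Delta> * (result (fft b m ys) ! \<nu>)"
    unfolding 1 sum_distrib_left[symmetric] by simp
  finally show ?thesis
    by (simp add: norm_mult ys_def \<nu>_def)
qed

lemma comp_S_tilde_result: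
  assumes "b > 1"
  shows "result (comp_S_tilde b a kt l m (samples b a \<Delta> f m)) = S_tilde b a \<Delta> kt l m f"
  by (simp add: comp_S_tilde_def S_tilde_def sum_list_upt norm_fft_samples[OF assms])

text \<open>The extra 2 pays for the multiplication by \<open>err_const\<close> and the comparison,
  so that the bound covers a whole stopping test.\<close>

lemma comp_S_tilde_cost:
  assumes "b > 1" "l \<le> m" "m \<ge> 1" "length ys = b ^ m"
  shows "evals (comp_S_tilde b a kt l m ys) = 0"
    and "ops (comp_S_tilde b a kt l m ys) + 2 \<le> (2 * b + 5) * m * b ^ m"
proof -
  show "evals (comp_S_tilde b a kt l m ys) = 0"
    using fft_stages_cost[of b m ys] by (simp add: comp_S_tilde_def fft_def sum_list_triv)
  have "ops (comp_S_tilde b a kt l m ys) = m * b ^ m * (2 * b) + b ^ m + 2 * (b ^ l - b ^ l div b)"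
    using fft_stages_cost[of b m ys] assms(4) div_le_dividend[of "b ^ l" b]
    by (simp add: comp_S_tilde_def fft_def sum_list_triv del: div_le_dividend)
  also have "b ^ l - b ^ l div b \<le> b ^ m"
    using assms(1,2) by (intro order_trans[OF diff_le_self power_increasing]) auto
  finally have "ops (comp_S_tilde b a kt l m ys) + 2 \<le> m * b ^ m * (2 * b) + 3 * b ^ m + 2"
    by simp
  \<comment> \<open>One \<open>b ^ m\<close> comes from the scaling, two from moduli and their sum;
    the constant 2 is absorbed by two more. \<open>m \<ge> 1\<close> then allows the common factor
    \<open>m * b ^ m\<close>.\<close>
  also have "\<dots> \<le> m * b ^ m * (2 * b) + 5 * (m * b ^ m)"
  proof -
    have "b ^ m \<le> m * b ^ m" "1 \<le> b ^ m"
      using assms by auto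
    then show ?thesis by linarith
  qed
  finally show "ops (comp_S_tilde b a kt l m ys) + 2 \<le> (2 * b + 5) * m * b ^ m"
    by (simp add: algebra_simps)
qed

lemma comp_cubature_simps:
  "result (comp_cubature b m (samples b a \<Delta> f m)) = cubature b a \<Delta> m f"
  "evals (comp_cubature b m ys) = 0"
  "ops (comp_cubature b m ys) = length ys + 1"
  by (simp_all add: comp_cubature_def cubature_def samples_def sum_list_upt atLeast0LessThan)

lemma sample_simps:
  "result (sample b a \<Delta> f i i') = map (\<lambda>i. f (z_node b a i \<oplus> \<Delta>)) [i..<i']"
  "evals (sample b a \<Delta> f i i') = i' - i"
  "ops (sample b a \<Delta> f i i') = 0"
  by (simp_all add: sample_def sum_list_triv)

section \<open>Termination and accumulated cost of the adaptive loop\<close>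

lemma samples_Suc:
  assumes "b > 0"
  shows "samples b a \<Delta> f m @ result (sample b a \<Delta> f (b ^ m) (b ^ Suc m)) = samples b a \<Delta> f (Suc m)"
proof -
  have "b ^ m \<le> b ^ Suc m"
    using assms by simp
  then obtain k where k: "b ^ Suc m = b ^ m + k"
    using le_Suc_ex by blast
  show ?thesis
    unfolding samples_def sample_simps map_append[symmetric] k upt_add_eq_append[OF le0] ..
qed

text \<open>Induction downwards from the stopping level \<open>M\<close>. The summands with
  \<open>b ^ m\<close> on the left make the bounds inductive: the first \<open>b ^ m\<close> values
  are already paid for, and \<open>(2 * b + 5) * M * b ^ m\<close> is the slack by which the
  geometric sum of the test costs stays below twice its last term.\<close>

lemma adaptive_loop_terminates:
  fixes f :: "real^'d \<Rightarrow> complex"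
  assumes P_iff: "\<And>m. P m \<longleftrightarrow> err_const \<omega>h \<omega>r r m * S_tilde b a \<Delta> kt (m - r) m f \<le> \<epsilon>"
    and b: "b > 1" and "1 \<le> m" "m \<le> M" "P M" "\<And>m'. m \<le> m' \<Longrightarrow> m' < M \<Longrightarrow> \<not> P m'"
  shows "\<exists>out. adaptive_loop b a \<Delta> kt \<omega>h \<omega>r r f \<epsilon> m (samples b a \<Delta> f m) = Some out \<and>
     result out = cubature b a \<Delta> M f \<and> evals out + b ^ m = b ^ M \<and>
     ops out + (2 * b + 5) * M * b ^ m \<le> 2 * ((2 * b + 5) * M * b ^ M) + b ^ M + 1"
  using \<open>m \<le> M\<close> \<open>1 \<le> m\<close> assms(6)
proof (induction m rule: inc_induct)
  case base
  define test where "test = comp_S_tilde b a kt (M - r) M (samples b a \<Delta> f M) \<triangleright>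
    mulC (err_const \<omega>h \<omega>r r M) \<triangleright> (\<lambda>e. leqC e \<epsilon>)"
  have "result test"
    using \<open>P M\<close> by (simp add: test_def comp_S_tilde_result[OF b] P_iff)
  then have "adaptive_loop b a \<Delta> kt \<omega>h \<omega>r r f \<epsilon> M (samples b a \<Delta> f M) =
      Some (test \<triangleright> (\<lambda>_. comp_cubature b M (samples b a \<Delta> f M)))"
    by (subst adaptive_loop.simps) (simp add: test_def Let_def)
  moreover have "ops test \<le> (2 * b + 5) * M * b ^ M" "evals test = 0"
    using comp_S_tilde_cost[OF b diff_le_self base(1), of "samples b a \<Delta> f M" a kt r] by (simp_all add: test_def)
  ultimately show ?case
    by (simp add: comp_cubature_simps mult_ac)
next
  case (step m)
  define test where "test = comp_S_tilde b a kt (m - r) m (samples b a \<Delta> f m) \<triangleright>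
    mulC (err_const \<omega>h \<omega>r r m) \<triangleright> (\<lambda>e. leqC e \<epsilon>)"
  define new where "new = sample b a \<Delta> f (b ^ m) (b ^ Suc m)"
  obtain out where out: "adaptive_loop b a \<Delta> kt \<omega>h \<omega>r r f \<epsilon> (Suc m) (samples b a \<Delta> f (Suc m)) = Some out"
     "result out = cubature b a \<Delta> M f" "evals out + b ^ Suc m = b ^ M"
     "ops out + (2 * b + 5) * M * b ^ Suc m \<le> 2 * ((2 * b + 5) * M * b ^ M) + b ^ M + 1"
    using step.IH step.prems by auto
  have "\<not> P m"
    using step by blast
  then have "\<not> result test"
    by (simp add: test_def comp_S_tilde_result[OF b] P_iff)
  moreover have "samples b a \<Delta> f m @ result new = samples b a \<Delta> f (Suc m)"
    unfolding new_def using b by (intro samples_Suc) simp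
  ultimately have "adaptive_loop b a \<Delta> kt \<omega>h \<omega>r r f \<epsilon> m (samples b a \<Delta> f m) =
      Some (test \<triangleright> (\<lambda>_. new) \<triangleright> (\<lambda>_. out))"
    using out(1) by (subst adaptive_loop.simps) (simp add: test_def[symmetric] new_def[symmetric] Let_def del: power_Suc)
  moreover have "evals new + b ^ m = b ^ Suc m" "ops new = 0"
    using b by (simp_all add: new_def sample_simps)
  moreover have "evals test = 0" "ops test + ops out + (2 * b + 5) * M * b ^ m \<le> 2 * ((2 * b + 5) * M * b ^ M) + b ^ M + 1"
  proof -
    have test: "ops test \<le> (2 * b + 5) * m * b ^ m" "evals test = 0"
      using comp_S_tilde_cost[OF b diff_le_self step.prems(1), of "samples b a \<Delta> f m" a kt r] by (simp_all add: test_def)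
    then show "evals test = 0" by simp
    define X where "X = (2 * b + 5) * M * b ^ m"
    have "(2 * b + 5) * m * b ^ m \<le> X"
      unfolding X_def using step.hyps by (intro mult_le_mono) auto
    then have "ops test + X \<le> 2 * X"
      using test(1) by linarith
    \<comment> \<open>Here \<open>b \<ge> 2\<close> enters: the cost of this test and the slack at
      level \<open>m\<close> fit into the slack at level \<open>Suc m\<close>.\<close>
    also have "\<dots> \<le> b * X"
      using b by (intro mult_le_mono) auto
    also have "b * X = (2 * b + 5) * M * b ^ Suc m"
      by (simp add: X_def)
    finally have "ops test + ops out + X \<le> ops out + (2 * b + 5) * M * b ^ Suc m"
      by linarith
    then show "ops test + ops out + (2 * b + 5) * M * b ^ m \<le> 2 * ((2 * b + 5) * M * b ^ M) + b ^ M + 1"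
      unfolding X_def using out(4) by (rule order_trans)
  qed
  ultimately show ?case
    using out(2,3) by simp
qed

lemma adaptive_algorithm_terminates:
  fixes f :: "real^'d \<Rightarrow> complex"
  assumes P_iff: "\<And>m. P m \<longleftrightarrow> err_const \<omega>h \<omega>r r m * S_tilde b a \<Delta> kt (m - r) m f \<le> \<epsilon>"
    and b: "b > 1" and "1 \<le> ls" "ls + r \<le> M" "P M" "\<And>m. ls + r \<le> m \<Longrightarrow> m < M \<Longrightarrow> \<not> P m"
  shows "\<exists>out. adaptive_algorithm b a \<Delta> kt \<omega>h \<omega>r ls r f \<epsilon> = Some out \<and>
     result out = cubature b a \<Delta> M f \<and> evals out = b ^ M \<and>
     ops out \<le> (4 * b + 12) * M * b ^ M"
proof -
  define init where "init = sample b a \<Delta> f 0 (b ^ (ls + r))"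
  have init: "result init = samples b a \<Delta> f (ls + r)" "evals init = b ^ (ls + r)" "ops init = 0"
    by (simp_all add: init_def sample_simps samples_def)
  obtain out where out: "adaptive_loop b a \<Delta> kt \<omega>h \<omega>r r f \<epsilon> (ls + r) (samples b a \<Delta> f (ls + r)) = Some out"
     "result out = cubature b a \<Delta> M f" "evals out + b ^ (ls + r) = b ^ M"
     "ops out + (2 * b + 5) * M * b ^ (ls + r) \<le> 2 * ((2 * b + 5) * M * b ^ M) + b ^ M + 1"
    using adaptive_loop_terminates[OF P_iff b, of "ls + r" M] assms by auto
  have "adaptive_algorithm b a \<Delta> kt \<omega>h \<omega>r ls r f \<epsilon> = Some (init \<triangleright> (\<lambda>_. out))"
    using out(1) init(1) by (simp add: adaptive_algorithm_def Let_def init_def[symmetric])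
  moreover have "ops out \<le> (4 * b + 12) * M * b ^ M"
  proof -
    have "b ^ M \<le> M * b ^ M" "1 \<le> b ^ M"
      using assms by auto
    \<comment> \<open>Twice \<open>2 * b + 5\<close> from the tests, and 2 for the final cubature
      sum \<open>b ^ M + 1\<close>.\<close>
    moreover have "(4 * b + 12) * M * b ^ M = 2 * ((2 * b + 5) * M * b ^ M) + 2 * (M * b ^ M)"
      by (simp add: algebra_simps)
    ultimately show ?thesis
      using out(4) by linarith
  qed
  ultimately show ?thesis
    using out init by simp
qed

theorem theorem1:
  fixes b :: nat and a :: "nat \<Rightarrow> nat^'d" and \<Delta> :: "real^'d" and kt :: "nat \<Rightarrow> int^'d"
    and \<omega>h \<omega>r :: "nat \<Rightarrow> real" and ls r :: nat
  assumes "prime b"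
    and "lattice_digits b a"
    and "\<Delta> \<in> unit_cube"
    and "wavenumber_map b a kt"
    and "ls \<ge> 1"
    and "\<And>n. \<omega>h n \<ge> 0" and "\<And>n. \<omega>r n \<ge> 0"
    and "bounded (range \<omega>h)" and "bounded (range \<omega>r)"
    and "\<omega>r \<longlonglongrightarrow> 0"
    and "r \<ge> 1" and "\<omega>h r * \<omega>r r < 1"
  shows "\<exists>c :: real. \<forall>f \<in> integrand_cone b kt ls \<omega>h \<omega>r. \<forall>\<epsilon> > 0. \<forall>price \<ge> 0.
    (let M = {m. m \<ge> ls + r \<and>
                 err_const \<omega>h \<omega>r r m * S_tilde b a \<Delta> kt (m - r) m f \<le> \<epsilon>};
         Mstar = {m. m \<ge> ls + r \<and>
                 err_const \<omega>h \<omega>r r m * (1 + \<omega>h r * \<omega>r r) * S_sum b kt (m - r) f \<le> \<epsilon>};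
         m = (LEAST m. m \<in> M);
         mstar = (LEAST m. m \<in> Mstar)
     in M \<noteq> {} \<and> Mstar \<noteq> {} \<and>
        (\<exists>out. adaptive_algorithm b a \<Delta> kt \<omega>h \<omega>r ls r f \<epsilon> = Some out \<and>
               result out = cubature b a \<Delta> m f \<and>
               norm (cube_integral f - cubature b a \<Delta> m f) \<le> \<epsilon> \<and>
               evals out = b ^ m \<and>
               b ^ m \<le> b ^ mstar \<and>
               run_cost price out
                 \<le> price * real (b ^ mstar) + c * real mstar * real (b ^ mstar)))"
proof (intro exI[of _ "real (4 * b + 12)"] ballI allI impI)
  fix f :: "real^'d \<Rightarrow> complex" and \<epsilon> price :: real
  assume cone: "f \<in> integrand_cone b kt ls \<omega>h \<omega>r" and "\<epsilon> > 0" and "price \<ge> 0"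
  have b: "b > 1"
    using \<open>prime b\<close> by (rule prime_gt_1_nat)
  note kt = \<open>wavenumber_map b a kt\<close>
  have f: "f \<in> AC_integrands"
    and hat: "\<And>l m. l \<le> m \<Longrightarrow> S_hat b kt l m f \<le> \<omega>h (m - l) * S_check b kt m f"
    and check: "\<And>l m. ls \<le> l \<Longrightarrow> l \<le> m \<Longrightarrow> S_check b kt m f \<le> \<omega>r (m - l) * S_sum b kt l f"
    using cone by (auto simp: integrand_cone_def)
  define q where "q = \<omega>h r * \<omega>r r"
  have q: "0 \<le> q" "q < 1"
    using assms by (auto simp: q_def)
  define C where "C = err_const \<omega>h \<omega>r r"
  have C: "C m = \<omega>h m * \<omega>r r / (1 - q)" "C m \<ge> 0" for m
    using assms q by (auto simp: C_def err_const_def q_def)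
  \<comment> \<open>The cone condition is used with \<open>l = m - r\<close>, which must be at least
    \<open>ls\<close>; hence the start at \<open>ls + r\<close>.\<close>
  have chk: "S_check b kt m f \<le> \<omega>r r * S_sum b kt (m - r) f" if "ls + r \<le> m" for m
    using check[of "m - r" m] that by simp
  have hat_r: "S_hat b kt (m - r) m f \<le> q * S_sum b kt (m - r) f" if "ls + r \<le> m" for m
  proof -
    have "S_hat b kt (m - r) m f \<le> \<omega>h r * S_check b kt m f"
      using hat[of "m - r" m] that by simp
    also have "\<dots> \<le> \<omega>h r * (\<omega>r r * S_sum b kt (m - r) f)"
      using chk[OF that] assms by (intro mult_left_mono) auto
    finally show ?thesis by (simp add: q_def)
  qed
  have diff: "\<bar>S_tilde b a \<Delta> kt (m - r) m f - S_sum b kt (m - r) f\<bar> \<le> q * S_sum b kt (m - r) f" if "ls + r \<le> m" for m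
    using S_tilde_diff[OF b kt f, of "m - r" m \<Delta>] hat_r[OF that] by simp
  \<comment> \<open>The first cone condition with \<open>l = 0\<close> contributes
    \<open>\<omega>h m\<close>, the second with \<open>l = m - r\<close> contributes
    \<open>\<omega>r r\<close>: the numerator of \<open>err_const\<close>.\<close>
  have error: "norm (cube_integral f - cubature b a \<Delta> m f) \<le> C m * S_tilde b a \<Delta> kt (m - r) m f" if "ls + r \<le> m" for m
  proof -
    have "norm (cube_integral f - cubature b a \<Delta> m f) \<le> \<omega>h m * S_check b kt m f"
      using cubature_error[OF b kt f, of \<Delta> m] hat[of 0 m] by simp
    also have "\<dots> \<le> \<omega>h m * (\<omega>r r * S_sum b kt (m - r) f)"
      using chk[OF that] assms by (intro mult_left_mono) auto
    \<comment> \<open>\<open>S_sum\<close> is not computable from data; the factor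
      \<open>1 - q\<close> is inserted so that it can be replaced by \<open>S_tilde\<close>.\<close>
    also have "\<dots> = C m * ((1 - q) * S_sum b kt (m - r) f)"
      using q by (simp add: C)
    also have "(1 - q) * S_sum b kt (m - r) f \<le> S_tilde b a \<Delta> kt (m - r) m f"
      using diff[OF that] by (simp add: abs_le_iff algebra_simps)
    finally show ?thesis
      using C(2) by (simp add: mult_left_mono)
  qed
  define M where "M = {m. m \<ge> ls + r \<and> C m * S_tilde b a \<Delta> kt (m - r) m f \<le> \<epsilon>}"
  define Mstar where "Mstar = {m. m \<ge> ls + r \<and> C m * (1 + q) * S_sum b kt (m - r) f \<le> \<epsilon>}"
  have "Mstar \<subseteq> M"
  proof
    fix m assume m: "m \<in> Mstar"
    then have "S_tilde b a \<Delta> kt (m - r) m f \<le> (1 + q) * S_sum b kt (m - r) f"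
      using diff[of m] by (simp add: Mstar_def abs_le_iff algebra_simps)
    then have "C m * S_tilde b a \<Delta> kt (m - r) m f \<le> C m * ((1 + q) * S_sum b kt (m - r) f)"
      using C(2) by (rule mult_left_mono)
    with m show "m \<in> M"
      by (simp add: M_def Mstar_def mult.assoc)
  qed
  have "Mstar \<noteq> {}"
  proof -
    obtain B where B: "\<And>m. \<omega>h m \<le> B"
      using \<open>bounded (range \<omega>h)\<close> by (auto simp: bounded_iff abs_le_iff)
    \<comment> \<open>A bound for \<open>C m * (1 + q)\<close> that is uniform in \<open>m\<close>,
      so that the decay of \<open>S_sum\<close> alone decides.\<close>
    define D where "D = B * \<omega>r r / (1 - q) * (1 + q)"
    have "(\<lambda>m. D * S_sum b kt m f) \<longlonglongrightarrow> D * 0"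
      by (intro tendsto_mult tendsto_const S_sum_tendsto_0[OF b kt f])
    then have "\<forall>\<^sub>F m in sequentially. D * S_sum b kt m f < \<epsilon>"
      using \<open>\<epsilon> > 0\<close> by (intro order_tendstoD) auto
    then obtain N where N: "\<And>m. m \<ge> N \<Longrightarrow> D * S_sum b kt m f < \<epsilon>"
      by (auto simp: eventually_sequentially)
    \<comment> \<open>Chosen so that \<open>m - r \<ge> N\<close> and \<open>m \<ge> ls + r\<close>
      hold together.\<close>
    define m where "m = max N ls + r"
    have "C m \<le> B * \<omega>r r / (1 - q)"
      unfolding C using B assms q by (intro divide_right_mono mult_right_mono) auto
    then have "C m * (1 + q) * S_sum b kt (m - r) f \<le> D * S_sum b kt (m - r) f"
      unfolding D_def using q by (intro mult_right_mono) (auto simp: S_sum_def sum_nonneg)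
    also have "\<dots> < \<epsilon>"
      by (rule N) (simp add: m_def)
    finally have "m \<in> Mstar"
      by (simp add: Mstar_def m_def)
    then show ?thesis by blast
  qed
  define m where "m = (LEAST m. m \<in> M)"
  define mstar where "mstar = (LEAST m. m \<in> Mstar)"
  have "mstar \<in> Mstar"
    unfolding mstar_def using \<open>Mstar \<noteq> {}\<close> by (auto intro: LeastI)
  then have "mstar \<in> M"
    using \<open>Mstar \<subseteq> M\<close> by blast
  then have m: "m \<in> M" "m \<le> mstar"
    unfolding m_def by (rule LeastI, rule Least_le)
  have m_min: "m' \<notin> M" if "m' < m" for m'
    using that unfolding m_def by (rule not_less_Least)
  obtain out where out: "adaptive_algorithm b a \<Delta> kt \<omega>h \<omega>r ls r f \<epsilon> = Some out"
    "result out = cubature b a \<Delta> m f" "evals out = b ^ m" "ops out \<le> (4 * b + 12) * m * b ^ m"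
    using adaptive_algorithm_terminates[OF refl b \<open>ls \<ge> 1\<close>, of r m \<omega>h \<omega>r a \<Delta> kt f \<epsilon>] m(1) m_min
    by (auto simp: M_def C_def)
  have pow: "b ^ m \<le> b ^ mstar"
    using m(2) b by (intro power_increasing) auto
  have "ops out \<le> (4 * b + 12) * mstar * b ^ mstar"
    using out(4) m(2) pow by (meson le_refl le_trans mult_le_mono)
  then have "real (ops out) \<le> real ((4 * b + 12) * mstar * b ^ mstar)"
    by (simp only: of_nat_le_iff)
  moreover have "price * real (evals out) \<le> price * real (b ^ mstar)"
    using out(3) pow \<open>price \<ge> 0\<close> by (intro mult_left_mono) (simp_all only: of_nat_le_iff)
  ultimately have "run_cost price out \<le> price * real (b ^ mstar) + real (4 * b + 12) * real mstar * real (b ^ mstar)"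
    unfolding run_cost_def of_nat_mult by linarith
  moreover have "norm (cube_integral f - cubature b a \<Delta> m f) \<le> \<epsilon>"
    using error[of m] m(1) by (simp add: M_def)
  ultimately show "let M = {m. m \<ge> ls + r \<and>
                 err_const \<omega>h \<omega>r r m * S_tilde b a \<Delta> kt (m - r) m f \<le> \<epsilon>};
         Mstar = {m. m \<ge> ls + r \<and>
                 err_const \<omega>h \<omega>r r m * (1 + \<omega>h r * \<omega>r r) * S_sum b kt (m - r) f \<le> \<epsilon>};
         m = (LEAST m. m \<in> M);
         mstar = (LEAST m. m \<in> Mstar)
     in M \<noteq> {} \<and> Mstar \<noteq> {} \<and>
        (\<exists>out. adaptive_algorithm b a \<Delta> kt \<omega>h \<omega>r ls r f \<epsilon> = Some out \<and>
               result out = cubature b a \<Delta> m f \<and>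
               norm (cube_integral f - cubature b a \<Delta> m f) \<le> \<epsilon> \<and>
               evals out = b ^ m \<and>
               b ^ m \<le> b ^ mstar \<and>
               run_cost price out
                 \<le> price * real (b ^ mstar) + real (4 * b + 12) * real mstar * real (b ^ mstar))"
    unfolding Let_def C_def[symmetric] q_def[symmetric] M_def[symmetric] Mstar_def[symmetric]
      m_def[symmetric] mstar_def[symmetric]
    using \<open>mstar \<in> M\<close> \<open>Mstar \<noteq> {}\<close> out pow by blast
qed

end
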